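(* Let $R>1$, $\mathrm{gap}=1/R$, $m\in\mathbb N$, and let $A\in\mathbb R^{n\times n}$ be a symmetric matrix of bandwidth $b$ whose eigenvalues all lie in $[-R,-1]\cup[1,R]$. Then for every off-diagonal block $\Pi_{<0}(A)|_{\mathrm{off}}$ of the spectral projector $\Pi_{<0}(A)$, $$\sigma_{2mb+1}\big(\Pi_{<0}(A)|_{\mathrm{off}}\big)\le 2\exp\!\Big(-\frac{\pi^2 m}{4\log\big(4/\sqrt[4]{\mathrm{gap}}+2\big)}\Big).$$
   Context: A matrix has bandwidth $b$ if its $(i,j)$ entry vanishes whenever $|i-j|>b$. $\Pi_{<0}(A)$ is the orthogonal projector onto the span of the eigenvectors of $A$ belonging to negative eigenvalues. $\sigma_i(\cdot)$ denotes the $i$-th largest singular value (taken to be $0$ if $i$ exceeds the smaller dimension). An off-diagonal block of an $n\times n$ matrix $M$ is a submatrix $M(I,J)$ where, for some $1\le k<n$, either $I\subseteq\{1,\dots,k\}$, $J\subseteq\{k+1,\dots,n\}$, or $I\subseteq\{k+1,\dots,n\}$, $J\subseteq\{1,\dots,k\}$. $\log$ is the natural logarithm. *)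

theory Defs
  imports "Jordan_Normal_Form.Jordan_Normal_Form" "Jordan_Normal_Form.DL_Submatrix"
    "Jordan_Normal_Form.VS_Connect" "HOL-Library.Multiset"
begin

definition has_bandwidth :: "real mat \<Rightarrow> nat \<Rightarrow> bool" where
  "has_bandwidth A b \<longleftrightarrow>
     (\<forall>i<dim_row A. \<forall>j<dim_col A. b < nat \<bar>int i - int j\<bar> \<longrightarrow> A $$ (i,j) = 0)"

definition neg_eigenspace :: "real mat \<Rightarrow> real vec set" where
  "neg_eigenspace A =
     LinearCombinations.module.span class_ring (module_vec TYPE(real) (dim_row A)) {v. \<exists>e::real. e < 0 \<and> eigenvector A v e}"

definition is_orth_projector :: "nat \<Rightarrow> real mat \<Rightarrow> real vec set \<Rightarrow> bool" where
  "is_orth_projector n P S \<longleftrightarrow>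
     P \<in> carrier_mat n n \<and> transpose_mat P = P \<and> P * P = P \<and>
     (\<lambda>x. P *\<^sub>v x) ` carrier_vec n = S"

definition Pi_neg :: "real mat \<Rightarrow> real mat" where
  "Pi_neg A = (THE P. is_orth_projector (dim_row A) P (neg_eigenspace A))"

definition singular_values :: "real mat \<Rightarrow> real list" where
  "singular_values M =
     map sqrt (rev (sorted_list_of_multiset (proots (char_poly (transpose_mat M * M)))))"

definition sigma :: "nat \<Rightarrow> real mat \<Rightarrow> real" where
  "sigma i M = (if 1 \<le> i \<and> i \<le> length (singular_values M) then singular_values M ! (i - 1) else 0)"

definition off_diag_block_index :: "nat \<Rightarrow> nat set \<Rightarrow> nat set \<Rightarrow> bool" where
  "off_diag_block_index n I J \<longleftrightarrow>
     (\<exists>k. 1 \<le> k \<and> k < n \<and>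
        ((I \<subseteq> {0..<k} \<and> J \<subseteq> {k..<n}) \<or> (I \<subseteq> {k..<n} \<and> J \<subseteq> {0..<k})))"

end

theory Submission
  imports Defs "Jordan_Normal_Form.Spectral_Radius"
    "HOL-Analysis.Gamma_Function" "HOL-Analysis.Harmonic_Numbers"
begin

text \<open>
  For \<open>q(x) = \<Prod>\<^sub>j (x + p\<^sub>j)\<close> with \<open>2m\<close> positive \<open>p\<^sub>j\<close>, the odd function
  \<open>r(x) = (q(x) - q(-x)) / (q(x) + q(-x))\<close> is close to the sign function on \<open>[-R,-1] \<union> [1,R]\<close> when
  \<open>g(x) = |q(-x) / q(x)| = \<Prod>\<^sub>j |x - p\<^sub>j| / (x + p\<^sub>j)\<close> is small on \<open>[1,R]\<close>.

  Since \<open>E = q(A) + q(-A)\<close> and \<open>q(A) - q(-A)\<close> have bandwidth \<open>2mb\<close> and \<open>E\<close> is positive definite,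
  every off-diagonal block of \<open>r(A)\<close> has rank at most \<open>2mb\<close>, so the singular value is bounded by the
  error of approximating the projector by \<open>I/2 - \<kappa> r(A)\<close>, which is at most \<open>max g\<close> for the best \<open>\<kappa>\<close>.

  In logarithmic coordinates \<open>- ln g\<close> is the sum of \<open>ln coth (|u - a\<^sub>j| / 2)\<close>.  For a full lattice of
  spacing \<open>h\<close> this sum is smallest half-way between lattice points, where Jacobi's imaginary
  transformation bounds it below by \<open>\<pi>\<^sup>2 / (2h) - ln 2\<close>.  A finite lattice overhanging \<open>[0, ln R]\<close> by
  at least \<open>ln 16\<close> on both sides does as well as the full one once the overhanging points are moved to
  the end points of the interval, provided \<open>h\<close> is not too large; for large \<open>h\<close> the claimed bound exceeds
  \<open>1/2\<close> and is trivial.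
\<close>

unbundle no vec_syntax and no inner_syntax
hide_type (open) Finite_Cartesian_Product.vec
hide_const (open) Finite_Cartesian_Product.vec Finite_Cartesian_Product.mat Sigma_Algebra.sigma

section \<open>Partial fractions and a theta inequality\<close>

text \<open>The Euler constant cancels between the two series. The expansions of tanh and coth below
  are imaginary parts of series of this form.\<close>

lemma Digamma_diff_sums:
  fixes a b :: complex
  assumes "a \<noteq> 0" "b \<noteq> 0"
  shows "(\<lambda>k. inverse (a + of_nat k) - inverse (b + of_nat k)) sums (Digamma b - Digamma a)"
proof -
  have "(\<lambda>k. (inverse (of_nat (Suc k)) - inverse (b + of_nat k))
           - (inverse (of_nat (Suc k)) - inverse (a + of_nat k)))
        sums ((Digamma b + euler_mascheroni) - (Digamma a + euler_mascheroni))"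
    using summable_sums[OF summable_Digamma[OF assms(1)]] summable_sums[OF summable_Digamma[OF assms(2)]]
    by (intro sums_diff) (simp_all add: Digamma_def)
  thus ?thesis by simp
qed

text \<open>Differentiate \<open>rGamma z * rGamma (1 - z) = sin (pi * z) / pi\<close> once by the
  product rule and once directly, then divide by the product.\<close>

lemma Digamma_reflection:
  fixes z :: complex
  assumes "z \<notin> \<int>"
  shows "Digamma (1 - z) - Digamma z = of_real pi * cos (of_real pi * z) / sin (of_real pi * z)"
proof -
  have nz: "z \<notin> \<int>\<^sub>\<le>\<^sub>0" using assms nonpos_Ints_Int by blast
  have "1 - z \<notin> \<int>"
  proof
    assume "1 - z \<in> \<int>"
    hence "1 - (1 - z) \<in> \<int>" using Ints_1 Ints_diff by blast
    thus False using assms by simp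
  qed
  hence nz': "1 - z \<notin> \<int>\<^sub>\<le>\<^sub>0" using nonpos_Ints_Int by blast
  have "((\<lambda>w. rGamma (1 - w)) has_field_derivative - (- rGamma (1 - z) * Digamma (1 - z))) (at z)"
    by (rule derivative_eq_intros refl | simp add: nz')+
  from DERIV_mult[OF has_field_derivative_rGamma_no_nonpos_int[OF nz, of UNIV] this]
  have "((\<lambda>w. rGamma w * rGamma (1 - w)) has_field_derivative
          rGamma z * rGamma (1 - z) * (Digamma (1 - z) - Digamma z)) (at z)"
    by (simp add: algebra_simps)
  moreover have "((\<lambda>w. rGamma w * rGamma (1 - w)) has_field_derivative cos (of_real pi * z)) (at z)"
    unfolding rGamma_reflection_complex by (auto intro!: derivative_eq_intros)
  ultimately have eq: "rGamma z * rGamma (1 - z) * (Digamma (1 - z) - Digamma z) = cos (of_real pi * z)"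
    by (rule DERIV_unique)
  have "sin (of_real pi * z) \<noteq> 0"
  proof
    assume "sin (of_real pi * z) = 0"
    then obtain n where "of_real pi * z = of_real (of_int n * pi)" by (auto simp: sin_eq_0)
    hence "z = of_int n" by simp
    thus False using assms by simp
  qed
  thus ?thesis using eq unfolding rGamma_reflection_complex by (simp add: field_simps)
qed

lemma sin_i_of_real: "sin (\<i> * of_real t) = \<i> * of_real (sinh t)"
  using sinh_real[of t] by (simp add: sinh_field_def exp_minus)

lemma cos_i_of_real: "cos (\<i> * of_real t) = of_real (cosh t)"
  using cosh_real[of t] by (simp add: cosh_field_def exp_minus)

text \<open>At z = 1/2 + i y/2 the cotangent of the reflection formula becomes -i tanh(pi y/2).
  There 1 - z is the conjugate of z, so each difference of inverses is purely imaginary.\<close>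

lemma tanh_partial_fractions:
  fixes y :: real
  shows "(\<lambda>k. 4 * y / ((2 * real k + 1)\<^sup>2 + y\<^sup>2)) sums (pi * tanh (pi * y / 2))"
proof -
  define z where "z = Complex (1/2) (y/2)"
  have z1: "1 - z = Complex (1/2) (- y/2)" by (simp add: z_def complex_eq_iff)
  have "z \<notin> \<int>"
  proof
    assume "z \<in> \<int>"
    then obtain n where "z = of_int n" by (auto elim: Ints_cases)
    hence "Re z = of_int n" by simp
    hence "2 * of_int n = (1::real)" by (simp add: z_def)
    hence "of_int (2 * n) = (of_int 1::real)" by simp
    hence "2 * n = 1" by (simp only: of_int_eq_iff)
    thus False by presburger
  qed
  note refl = Digamma_reflection[OF this]
  have pz: "of_real pi * z = of_real (pi / 2) + \<i> * of_real (pi * y / 2)"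
    by (simp add: z_def complex_eq_iff)
  have c: "cos (of_real pi * z) = - sin (\<i> * of_real (pi * y / 2))"
          "sin (of_real pi * z) = cos (\<i> * of_real (pi * y / 2))"
    unfolding pz cos_add sin_add by (simp_all flip: cos_of_real sin_of_real)
  have "Digamma (1 - z) - Digamma z = - \<i> * of_real (pi * tanh (pi * y / 2))"
    unfolding refl c sin_i_of_real cos_i_of_real by (simp add: tanh_def)
  moreover have "z \<noteq> 0" "1 - z \<noteq> 0" unfolding z1 by (auto simp: z_def complex_eq_iff)
  ultimately have "(\<lambda>k. inverse (z + of_nat k) - inverse ((1 - z) + of_nat k)) sums (- \<i> * of_real (pi * tanh (pi * y / 2)))"
    using Digamma_diff_sums[of z "1 - z"] by simp
  hence "(\<lambda>k. - Im (inverse (z + of_nat k) - inverse ((1 - z) + of_nat k))) sums (pi * tanh (pi * y / 2))"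
    using sums_minus[OF sums_Im] by fastforce
  moreover have "- Im (inverse (z + of_nat k) - inverse ((1 - z) + of_nat k)) = 4 * y / ((2 * real k + 1)\<^sup>2 + y\<^sup>2)" for k
  proof -
    define w where "w = (1/2 + real k)\<^sup>2 + (y/2)\<^sup>2"
    have w: "(2 * real k + 1)\<^sup>2 + y\<^sup>2 = 4 * w" by (simp add: w_def power2_eq_square field_simps)
    have "z + of_nat k = Complex (1/2 + real k) (y/2)" "1 - z + of_nat k = Complex (1/2 + real k) (- y/2)"
      by (simp_all add: z_def complex_eq_iff)
    hence "- Im (inverse (z + of_nat k) - inverse ((1 - z) + of_nat k)) = (y/2) / w + (y/2) / w"
      by (simp add: w_def)
    thus ?thesis unfolding w by simp
  qed
  ultimately show ?thesis by simp
qed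

text \<open>Reflection on the imaginary axis, z = i y. Passing from \<open>Digamma z\<close> to
  \<open>Digamma (1 + z)\<close> splits off the pole, which is the \<open>1 / y\<close> on the
  right, and leaves the conjugate pair 1 + z, 1 - z.\<close>

lemma coth_partial_fractions:
  fixes y :: real
  assumes "y \<noteq> 0"
  shows "(\<lambda>k. 2 * y / ((real k + 1)\<^sup>2 + y\<^sup>2)) sums (pi * cosh (pi * y) / sinh (pi * y) - 1 / y)"
proof -
  define z where "z = Complex 0 y"
  have "z \<notin> \<int>"
    using assms by (auto simp: z_def complex_is_Int_iff)
  note refl = Digamma_reflection[OF this]
  have pz: "of_real pi * z = \<i> * of_real (pi * y)"
    by (simp add: z_def complex_eq_iff)
  have z0: "z \<noteq> 0" "1 + z \<noteq> 0" "1 - z \<noteq> 0" using assms by (auto simp: z_def complex_eq_iff)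
  have sh: "sinh (pi * y) \<noteq> 0" using assms by simp
  have "Digamma (1 - z) - Digamma (1 + z) = of_real pi * cos (of_real pi * z) / sin (of_real pi * z) - 1 / z"
    using refl Digamma_plus1[OF z0(1)] by (simp add: add.commute algebra_simps)
  also have "\<dots> = - \<i> * of_real (pi * cosh (pi * y) / sinh (pi * y) - 1 / y)"
    unfolding pz sin_i_of_real cos_i_of_real using sh assms
    by (simp add: z_def complex_eq_iff Re_divide Im_divide power2_eq_square) 
  finally have "(\<lambda>k. inverse ((1 + z) + of_nat k) - inverse ((1 - z) + of_nat k)) sums (- \<i> * of_real (pi * cosh (pi * y) / sinh (pi * y) - 1 / y))"
    using Digamma_diff_sums[OF z0(2,3)] by simp
  hence "(\<lambda>k. - Im (inverse ((1 + z) + of_nat k) - inverse ((1 - z) + of_nat k))) sums (pi * cosh (pi * y) / sinh (pi * y) - 1 / y)"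
    using sums_minus[OF sums_Im] by fastforce
  moreover have "- Im (inverse ((1 + z) + of_nat k) - inverse ((1 - z) + of_nat k)) = 2 * y / ((real k + 1)\<^sup>2 + y\<^sup>2)" for k
  proof -
    have "1 + z + of_nat k = Complex (real k + 1) y" "1 - z + of_nat k = Complex (real k + 1) (- y)"
      by (simp_all add: z_def complex_eq_iff)
    thus ?thesis by simp
  qed
  ultimately show ?thesis by simp
qed

text \<open>The odd multiples of pi come from tanh(x/2), the even ones from coth(x/2), and coth(x/2)
  - tanh(x/2) = 2 / sinh x.\<close>

lemma csch_partial_fractions:
  fixes x :: real
  assumes "x > 0"
  shows "(\<lambda>l. 2 * x / (x\<^sup>2 + (pi * real (2 * l + 1))\<^sup>2) - 2 * x / (x\<^sup>2 + (pi * real (2 * l + 2))\<^sup>2))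
    sums (1 / x - 1 / sinh x)"
proof -
  have odd: "2 * x / (x\<^sup>2 + (pi * real (2 * l + 1))\<^sup>2) = 1 / (2 * pi) * (4 * (x / pi) / ((2 * real l + 1)\<^sup>2 + (x / pi)\<^sup>2))" for l
  proof -
    have "(2 * real l + 1)\<^sup>2 + (x / pi)\<^sup>2 = (x\<^sup>2 + (pi * real (2 * l + 1))\<^sup>2) / pi\<^sup>2"
      by (simp add: field_simps power2_eq_square)
    thus ?thesis by (simp add: power2_eq_square)
  qed
  have even: "2 * x / (x\<^sup>2 + (pi * real (2 * l + 2))\<^sup>2) = 1 / (2 * pi) * (2 * (x / (2 * pi)) / ((real l + 1)\<^sup>2 + (x / (2 * pi))\<^sup>2))" for l
  proof -
    have "(real l + 1)\<^sup>2 + (x / (2 * pi))\<^sup>2 = (x\<^sup>2 + (pi * real (2 * l + 2))\<^sup>2) / (4 * pi\<^sup>2)"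
      by (simp add: field_simps power2_eq_square)
    thus ?thesis by (simp add: power2_eq_square)
  qed
  have "(\<lambda>l. 2 * x / (x\<^sup>2 + (pi * real (2 * l + 1))\<^sup>2) - 2 * x / (x\<^sup>2 + (pi * real (2 * l + 2))\<^sup>2))
    sums (1 / (2 * pi) * (pi * tanh (pi * (x / pi) / 2)) 
        - 1 / (2 * pi) * (pi * cosh (pi * (x / (2 * pi))) / sinh (pi * (x / (2 * pi))) - 1 / (x / (2 * pi))))"
    unfolding odd even using assms
    by (intro sums_diff sums_mult tanh_partial_fractions coth_partial_fractions) simp
  also have "1 / (2 * pi) * (pi * tanh (pi * (x / pi) / 2)) 
        - 1 / (2 * pi) * (pi * cosh (pi * (x / (2 * pi))) / sinh (pi * (x / (2 * pi))) - 1 / (x / (2 * pi)))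
      = 1 / x - 1 / 2 * (cosh (x/2) / sinh (x/2) - sinh (x/2) / cosh (x/2))"
    by (simp add: tanh_def field_simps)
  also have "cosh (x/2) / sinh (x/2) - sinh (x/2) / cosh (x/2) = 2 / sinh x"
  proof -
    have c: "cosh (x/2) > 0" "sinh (x/2) > 0" using assms by auto
    have "sinh x = 2 * sinh (x/2) * cosh (x/2)" using sinh_double[of "x/2"] by simp
    moreover have "cosh (x/2) * cosh (x/2) - sinh (x/2) * sinh (x/2) = 1" 
      using hyperbolic_pythagoras[of "x/2"] by (simp add: power2_eq_square)
    ultimately show ?thesis using c by (simp add: field_simps)
  qed
  finally show ?thesis by simp
qed

text \<open>The even squares contribute a quarter of the Basel series, so pi^2/6 - pi^2/24
  remains.\<close>

lemma inverse_odd_squares_sums: "(\<lambda>n. 1 / (2 * real n + 1)\<^sup>2) sums (pi\<^sup>2 / 8)"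
proof -
  have f: "(\<lambda>n. 1 / (real n + 1)\<^sup>2) sums (pi\<^sup>2 / 6)"
    using inverse_squares_sums by (simp add: add.commute)
  have "(\<lambda>n. \<Sum>i\<in>{n * 2..<n * 2 + 2}. 1 / (real i + 1)\<^sup>2) sums (pi\<^sup>2 / 6)"
    by (rule sums_group[OF f]) simp
  moreover have "(\<Sum>i\<in>{n * 2..<n * 2 + 2}. 1 / (real i + 1)\<^sup>2) = 1 / (2 * real n + 1)\<^sup>2 + 1 / 4 * (1 / (real n + 1)\<^sup>2)" for n
  proof -
    have "{n * 2..<n * 2 + 2} = {n*2, n*2+1}" by auto
    moreover have "(2 + 2 * real n)\<^sup>2 = 4 * (real n + 1)\<^sup>2" by (simp add: power2_eq_square algebra_simps)
    ultimately show ?thesis by (simp add: algebra_simps)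
  qed
  ultimately have "(\<lambda>n. 1 / (2 * real n + 1)\<^sup>2 + 1 / 4 * (1 / (real n + 1)\<^sup>2)) sums (pi\<^sup>2 / 6)" by simp
  from sums_diff[OF this sums_mult[OF f, of "1/4"]] show ?thesis by simp
qed

text \<open>Expanding \<open>1 / sinh\<close> in partial fractions and summing over \<open>i\<close> first leaves the terms
  \<open>(-1)\<^sup>n tanh (\<pi>\<^sup>2 n / h) / n\<close>.  Consecutive \<open>n\<close> are paired so that all terms become nonnegative and
  the order of summation does not matter.\<close>

lemma sum_inverse_odd_sinh_ge:
  fixes h :: real
  assumes "h > 0"
  shows "(\<Sum>i<N. 4 / (h * (2 * real i + 1)\<^sup>2)) - ln 2
           \<le> (\<Sum>i<N. 2 / ((2 * real i + 1) * sinh ((2 * real i + 1) * h / 2)))"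
proof -
  define c where "c i = 2 * real i + 1" for i
  \<comment> \<open>An array with two known sums: over all i it gives \<open>a n\<close> (partial
    fractions of tanh at y = 2 pi n / h), and with alternating signs over n >= 1 it gives the i-th
    term of the claim (partial fractions of 1/sinh at x = c i h / 2).\<close>
  define s where "s n i = 2 * h / ((c i * h / 2)\<^sup>2 + (pi * real n)\<^sup>2)" for n i
  define a where "a n = tanh (pi\<^sup>2 * real n / h) / real n" for n
  have c0: "c i > 0" for i unfolding c_def by simp
  have s_sums: "s n sums a n" if "n > 0" for n
  proof -
    define y where "y = 2 * pi * real n / h"
    have y0: "y > 0" using that assms by (simp add: y_def)
    have "s n i = 2 / (h * y) * (4 * y / ((2 * real i + 1)\<^sup>2 + y\<^sup>2))" for i
    proof -
      have "(c i * h / 2)\<^sup>2 + (pi * real n)\<^sup>2 = (h / 2)\<^sup>2 * ((2 * real i + 1)\<^sup>2 + y\<^sup>2)"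
        using assms by (simp add: y_def c_def field_simps power2_eq_square)
      hence "s n i = 2 * h / ((h / 2)\<^sup>2 * ((2 * real i + 1)\<^sup>2 + y\<^sup>2))" unfolding s_def by simp
      also have "\<dots> = 2 * h / (h / 2)\<^sup>2 * (1 / ((2 * real i + 1)\<^sup>2 + y\<^sup>2))" by simp
      also have "2 * h / (h / 2)\<^sup>2 = 2 / (h * y) * (4 * y)" using assms y0 by (simp add: power2_eq_square)
      finally show ?thesis by simp
    qed
    moreover have "2 / (h * y) * (pi * tanh (pi * y / 2)) = a n"
      using assms that by (simp add: a_def y_def power2_eq_square)
    moreover from calculation(1) have "s n = (\<lambda>i. 2 / (h * y) * (4 * y / ((2 * real i + 1)\<^sup>2 + y\<^sup>2)))" ..
    ultimately show ?thesis
      using sums_mult[OF tanh_partial_fractions[of y], of "2 / (h * y)"] by (simp only:)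
  qed
  have s0: "s n i \<ge> 0" for n i unfolding s_def using assms by simp
  have s_anti: "s (2 * l + 2) i \<le> s (2 * l + 1) i" for l i
    unfolding s_def using assms c0[of i]
    by (intro divide_left_mono add_left_mono power_mono mult_left_mono mult_pos_pos add_nonneg_pos) (auto intro: add_pos_nonneg)
  have csch_sums: "(\<lambda>l. s (2 * l + 1) i - s (2 * l + 2) i) sums (4 / (h * (c i)\<^sup>2) - 2 / (c i * sinh (c i * h / 2)))" for i
  proof -
    have "0 < c i * h / 2" using c0[of i] assms by simp
    from sums_mult[OF csch_partial_fractions[OF this], of "2 / c i"]
    show ?thesis using c0[of i] assms
      by (simp add: s_def right_diff_distrib power2_eq_square[of "c i"] mult_ac cong: if_cong)
  qed
  have a_sums: "(\<lambda>i. s (2 * l + 1) i - s (2 * l + 2) i) sums (a (2 * l + 1) - a (2 * l + 2))" for l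
    by (intro sums_diff s_sums) simp_all
  \<comment> \<open>Extending the sum to all i adds only nonnegative terms and yields a difference
    of two values of \<open>a\<close>. Since (1 - tanh(pi^2 n / h)) / n decreases in n, replacing
    both tanh by 1 can only enlarge that difference. The resulting bounds add up to ln 2.\<close>
  have le: "(\<Sum>i<N. s (2 * l + 1) i - s (2 * l + 2) i) \<le> 1 / real (2 * l + 1) - 1 / real (2 * l + 2)" for l
  proof -
    have "(\<Sum>i<N. s (2 * l + 1) i - s (2 * l + 2) i) \<le> a (2 * l + 1) - a (2 * l + 2)"
      using sum_le_suminf[OF sums_summable[OF a_sums], of "{..<N}" l] sums_unique[OF a_sums[of l]] s_anti
      by simp
    also have "(1 - tanh (pi\<^sup>2 * real (2 * l + 2) / h)) / real (2 * l + 2) \<le> (1 - tanh (pi\<^sup>2 * real (2 * l + 1) / h)) / real (2 * l + 1)"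
      using assms less_imp_le[OF tanh_real_lt_1] 
      by (intro frac_le) (auto intro!: divide_right_mono mult_left_mono)
    hence "a (2 * l + 1) - a (2 * l + 2) \<le> 1 / real (2 * l + 1) - 1 / real (2 * l + 2)"
      unfolding a_def by (simp add: diff_divide_distrib)
    finally show ?thesis .
  qed
  have "(\<lambda>n. \<Sum>k\<in>{n * 2..<n * 2 + 2}. (-1)^k / real (Suc k)) sums ln 2"
    by (rule sums_group[OF alternating_harmonic_series_sums]) simp
  moreover have "(\<Sum>k\<in>{l * 2..<l * 2 + 2}. (-1)^k / real (Suc k)) = 1 / real (2 * l + 1) - 1 / real (2 * l + 2)" for l
  proof -
    have "{l * 2..<l * 2 + 2} = {l*2, l*2+1}" by auto
    thus ?thesis by (simp add: mult.commute add.commute)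
  qed
  ultimately have ln2: "(\<lambda>l. 1 / real (2 * l + 1) - 1 / real (2 * l + 2)) sums ln 2" by simp
  have "(\<lambda>l. \<Sum>i<N. s (2 * l + 1) i - s (2 * l + 2) i) sums (\<Sum>i<N. 4 / (h * (c i)\<^sup>2) - 2 / (c i * sinh (c i * h / 2)))"
    by (intro sums_sum csch_sums)
  from sums_le[OF le this ln2] show ?thesis by (simp add: sum_subtractf c_def)
qed

section \<open>The function ln coth(u/2) and its sums over lattices\<close>

text \<open>The value is ln coth(u/2), with the argument halved: it equals -ln tanh(u/2), and
  tanh(|u - a|/2) is the factor |x - p| / (x + p) at x = exp u, p = exp a.\<close>

definition ln_coth :: "real \<Rightarrow> real" where
  "ln_coth u = ln ((1 + exp (- u)) / (1 - exp (- u)))"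

text \<open>The series of ln((1 + q) / (1 - q)) at q = exp(-u). Its coefficients are positive, so
  sign, decay and convexity of \<open>ln_coth\<close> can be checked on single exponentials.\<close>

lemma ln_coth_sums:
  assumes "u > 0"
  shows "(\<lambda>i. 2 / (2 * real i + 1) * exp (- (2 * real i + 1) * u)) sums ln_coth u"
proof -
  define q where "q = exp (- u)"
  have q: "0 < q" "q < 1" using assms by (auto simp: q_def)
  define x where "x = (1 + q) / (1 - q)"
  have "x > 0" "(x - 1) / (x + 1) = q" using q by (auto simp: x_def field_simps)
  with ln_series_quadratic[of x] have "(\<lambda>n. 2 * q ^ (2 * n + 1) / of_nat (2 * n + 1)) sums ln x" by simp
  moreover have "q ^ (2 * n + 1) = exp (- (2 * real n + 1) * u)" for n
    unfolding q_def exp_of_nat_mult[symmetric] by (simp add: algebra_simps)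
  ultimately show ?thesis by (simp add: x_def q_def ln_coth_def add.commute)
qed

lemma ln_coth_nonneg: "u > 0 \<Longrightarrow> 0 \<le> ln_coth u"
  using sums_le[OF _ sums_zero ln_coth_sums] by simp

text \<open>Every exponential in the series decays at rate at least 1, so a shift by y gains a
  factor exp(-y) in each term.\<close>

lemma ln_coth_add_le:
  assumes "u > 0" "y \<ge> 0"
  shows "ln_coth (u + y) \<le> exp (- y) * ln_coth u"
proof (rule sums_le[OF _ ln_coth_sums sums_mult[OF ln_coth_sums]])
  fix i :: nat
  have "exp (- ((2 * real i + 1) * (u + y))) \<le> exp (- y - (2 * real i + 1) * u)"
    using assms by (simp add: algebra_simps)
  also have "\<dots> = exp (- y) * exp (- ((2 * real i + 1) * u))" by (simp only: exp_add[symmetric]) simp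
  finally have "exp (- (2 * real i + 1) * (u + y)) \<le> exp (- y) * exp (- (2 * real i + 1) * u)"
    by (simp only: mult_minus_left)
  from mult_left_mono[OF this, of "2 / (2 * real i + 1)"]
  show "2 / (2 * real i + 1) * exp (- (2 * real i + 1) * (u + y))
      \<le> exp (- y) * (2 / (2 * real i + 1) * exp (- (2 * real i + 1) * u))"
    by (simp only: mult.left_commute) simp
qed (use assms in auto)

text \<open>Termwise this is 2 p q <= p^2 + q^2, where p and q are exponentials with halved
  exponents.\<close>

lemma ln_coth_midpoint_convex:
  assumes "a > 0" "b > 0"
  shows "2 * ln_coth ((a + b) / 2) \<le> ln_coth a + ln_coth b"
proof (rule sums_le[OF _ sums_mult[OF ln_coth_sums] sums_add[OF ln_coth_sums ln_coth_sums]])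
  fix i :: nat
  define p q where "p = exp (- ((2 * real i + 1) * a) / 2)" and "q = exp (- ((2 * real i + 1) * b) / 2)"
  have "p * q = exp (- ((2 * real i + 1) * ((a + b) / 2)))" "p * p = exp (- ((2 * real i + 1) * a))" "q * q = exp (- ((2 * real i + 1) * b))"
    unfolding p_def q_def exp_add[symmetric] by (simp_all add: field_simps)
  moreover have "2 * (p * q) \<le> p * p + q * q" using sum_squares_bound[of p q] by (simp add: power2_eq_square)
  ultimately have "2 * exp (- ((2 * real i + 1) * ((a + b) / 2))) \<le> exp (- ((2 * real i + 1) * a)) + exp (- ((2 * real i + 1) * b))"
    by simp
  from mult_left_mono[OF this, of "2 / (2 * real i + 1)"]
  show "2 * (2 / (2 * real i + 1) * exp (- (2 * real i + 1) * ((a + b) / 2)))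
    \<le> 2 / (2 * real i + 1) * exp (- (2 * real i + 1) * a) + 2 / (2 * real i + 1) * exp (- (2 * real i + 1) * b)"
    by (simp only: mult_minus_left) (simp add: algebra_simps)
qed (use assms in auto)

lemma summable_ln_coth_lattice:
  assumes "u > 0" "h > 0"
  shows "summable (\<lambda>j. ln_coth (u + real j * h))"
    and "(\<Sum>j. ln_coth (u + real j * h)) \<le> ln_coth u / (1 - exp (- h))"
proof -
  have le: "ln_coth (u + real j * h) \<le> exp (- h) ^ j * ln_coth u" for j
    using ln_coth_add_le[of u "real j * h"] assms by (simp add: exp_of_nat_mult[symmetric])
  have g: "(\<lambda>j. exp (- h) ^ j * ln_coth u) sums (1 / (1 - exp (- h)) * ln_coth u)"
    using assms by (intro sums_mult2 geometric_sums) simp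
  show sm: "summable (\<lambda>j. ln_coth (u + real j * h))"
    using le assms by (intro summable_comparison_test[OF _ sums_summable[OF g]] exI[of _ 0])
      (auto simp: ln_coth_nonneg add_pos_nonneg)
  show "(\<Sum>j. ln_coth (u + real j * h)) \<le> ln_coth u / (1 - exp (- h))"
    using sums_le[OF le summable_sums[OF sm] g] by simp
qed

text \<open>Expand \<open>ln_coth\<close> into exponentials and sum over the lattice first: each
  exponential gives a geometric series with value 1 / (c sinh(c h / 2)). Truncating the expansion at
  N drops only nonnegative terms, so no interchange of infinite sums is needed. As N grows, the
  lower bound tends to (4/h) (pi^2/8) - ln 2.\<close>

lemma suminf_ln_coth_half_lattice_ge:
  assumes h: "h > 0"
  shows "pi\<^sup>2 / (2 * h) - ln 2 \<le> 2 * (\<Sum>j. ln_coth (h / 2 + real j * h))"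
proof -
  define c where "c i = 2 * real i + 1" for i
  define S where "S = (\<Sum>j. ln_coth (h / 2 + real j * h))"
  have c0: "c i > 0" for i unfolding c_def by simp
  have pos: "h / 2 + real j * h > 0" for j using h by (simp add: add_pos_nonneg)
  have geo: "(\<lambda>j. 2 / c i * exp (- c i * (h / 2 + real j * h))) sums (1 / (c i * sinh (c i * h / 2)))" for i
  proof -
    define q where "q = exp (- c i * h)"
    define r where "r = exp (- (c i * h / 2))"
    have q1: "q < 1" "q > 0" and r: "r > 0" using h c0[of i] by (auto simp: q_def r_def)
    have qr: "q = r * r" unfolding q_def r_def by (simp add: exp_add[symmetric])
    have "(\<lambda>j. 2 / c i * (r * q ^ j)) sums (2 / c i * (r * (1 / (1 - q))))"
      using q1 by (intro sums_mult geometric_sums) simp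
    moreover have "r * q ^ j = exp (- c i * (h / 2 + real j * h))" for j
      unfolding q_def r_def exp_of_nat_mult[symmetric] exp_add[symmetric] by (simp add: algebra_simps)
    moreover have "sinh (c i * h / 2) = (1 / r - r) / 2"
      by (simp add: sinh_field_def r_def exp_minus field_simps)
    hence "sinh (c i * h / 2) = (1 - q) / (2 * r)"
      using r by (simp add: qr field_simps)
    hence "2 / c i * (r * (1 / (1 - q))) = 1 / (c i * sinh (c i * h / 2))" by simp
    ultimately show ?thesis by (simp only:)
  qed
  have "(\<Sum>i<N. 4 / (h * (c i)\<^sup>2)) - ln 2 \<le> 2 * S" for N
  proof -
    have 1: "(\<lambda>j. \<Sum>i<N. 2 / c i * exp (- c i * (h / 2 + real j * h))) sums (\<Sum>i<N. 1 / (c i * sinh (c i * h / 2)))"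
      by (intro sums_sum geo)
    have 2: "(\<Sum>i<N. 2 / c i * exp (- c i * (h / 2 + real j * h))) \<le> ln_coth (h / 2 + real j * h)" for j
      using sum_le_suminf[OF sums_summable[OF ln_coth_sums[OF pos]], of "{..<N}" j] c0
        sums_unique[OF ln_coth_sums[OF pos[of j]]] by (simp add: c_def less_imp_le)
    have 3: "(\<lambda>j. ln_coth (h / 2 + real j * h)) sums S"
      unfolding S_def by (intro summable_sums summable_ln_coth_lattice) (use h in auto)
    from sums_le[OF 2 1 3] have "(\<Sum>i<N. 1 / (c i * sinh (c i * h / 2))) \<le> S" .
    moreover have "(\<Sum>i<N. 2 / (c i * sinh (c i * h / 2))) = 2 * (\<Sum>i<N. 1 / (c i * sinh (c i * h / 2)))"
      by (simp add: sum_distrib_left)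
    ultimately show ?thesis using sum_inverse_odd_sinh_ge[OF h, of N] unfolding c_def by linarith
  qed
  moreover have "(\<lambda>N. (\<Sum>i<N. 4 / (h * (c i)\<^sup>2)) - ln 2) \<longlonglongrightarrow> 4 / h * (pi\<^sup>2 / 8) - ln 2"
    using sums_mult[OF inverse_odd_squares_sums, of "4 / h"]
    by (intro tendsto_diff tendsto_const) (simp add: sums_def c_def)
  ultimately have "4 / h * (pi\<^sup>2 / 8) - ln 2 \<le> 2 * S"
    by (intro LIMSEQ_le_const2) auto
  thus ?thesis by (simp add: S_def)
qed

text \<open>The two series collect the lattice points on either side of a point. Terms of equal
  index have mean distance h/2 + j h, so by midpoint convexity the half-way position is the worst
  one.\<close>

lemma suminf_ln_coth_lattice_ge:
  assumes h: "h > 0" and a: "0 < a" "a < h"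
  shows "pi\<^sup>2 / (2 * h) - ln 2 \<le> (\<Sum>j. ln_coth (a + real j * h)) + (\<Sum>j. ln_coth (h - a + real j * h))"
proof -
  note sm = summable_ln_coth_lattice(1)[OF _ h]
  have "2 * ln_coth (h / 2 + real j * h) \<le> ln_coth (a + real j * h) + ln_coth (h - a + real j * h)" for j
  proof -
    have "((a + real j * h) + (h - a + real j * h)) / 2 = h / 2 + real j * h" by (simp add: field_simps)
    thus ?thesis using ln_coth_midpoint_convex[of "a + real j * h" "h - a + real j * h"] a
      unfolding \<open>_ / 2 = _\<close> by (simp add: add_pos_nonneg h less_imp_le)
  qed
  hence "(\<Sum>j. 2 * ln_coth (h / 2 + real j * h)) \<le> (\<Sum>j. ln_coth (a + real j * h) + ln_coth (h - a + real j * h))"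
    using a h by (intro suminf_le summable_add summable_mult sm) auto
  also have "\<dots> = (\<Sum>j. ln_coth (a + real j * h)) + (\<Sum>j. ln_coth (h - a + real j * h))"
    using a by (intro suminf_add[symmetric] sm) auto
  finally show ?thesis
    using suminf_ln_coth_half_lattice_ge[OF h] suminf_mult[OF sm[of "h/2"], of 2] h by simp
qed

section \<open>Small Blaschke quotients on an interval\<close>

lemma exp_neg_le_chord:
  fixes d h :: real
  assumes "0 < h" "0 \<le> d" "d \<le> h"
  shows "exp (- d) \<le> 1 - d / h * (1 - exp (- h))"
proof -
  have "convex_on {-h..0} exp" by (rule convex_on_subset[OF exp_convex]) auto
  from convex_onD_Icc''[OF this, of "-d"] have "exp (- d) \<le> (exp (- h) - 1) / h * d + 1"
    using assms by simp
  also have "\<dots> = 1 - d / h * (1 - exp (- h))" using assms by (simp add: field_simps)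
  finally show ?thesis .
qed

text \<open>Compares the lattice points left of u, continued to minus infinity, with finitely many
  points whose negative members are moved to 0. Points in [0, u) agree on both sides. The
  geometrically decaying tail beyond 0 must be paid for by the copies of \<open>ln_coth u\<close>
  that the moved points contribute; the first assumption on c says that there are enough of
  them.\<close>

lemma sum_ln_coth_clamped_ge:
  fixes h c u :: real
  defines "x \<equiv> \<lambda>j. (real j + 1 / 2) * h - c"
  assumes h: "h > 0" and N: "N > 0" "x (N - 1) < u" "u \<le> x N" and u: "u > 0"
    and c: "1 / (1 - exp (- h)) \<le> c / h + 1 / 2" "h < 2 * c"
  shows "(\<Sum>i. ln_coth (u - x (N - 1) + real i * h)) \<le> (\<Sum>j<N. ln_coth (u - max 0 (x j)))"
proof -
  define f where "f i = ln_coth (u - x (N - 1) + real i * h)" for i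
  \<comment> \<open>The number of lattice points below 0:
    \<open>x (\<nu> - 1) < 0 \<le> x \<nu>\<close>.\<close>
  define \<nu> where "\<nu> = nat \<lceil>c / h - 1 / 2\<rceil>"
  have "c / h - 1 / 2 > 0" using c h by (simp add: field_simps)
  hence \<nu>0: "\<nu> > 0" and r\<nu>: "c / h - 1 / 2 \<le> real \<nu>" "real \<nu> < c / h - 1 / 2 + 1"
    unfolding \<nu>_def by linarith+
  have mono: "x i \<le> x j" if "i \<le> j" for i j
    unfolding x_def using that h by (simp add: mult_right_mono)
  have x\<nu>: "x \<nu> \<ge> 0" "x (\<nu> - 1) < 0"
    using r\<nu> \<nu>0 h by (auto simp: x_def of_nat_diff field_simps)
  have "\<nu> \<le> N"
  proof (rule ccontr)
    assume "\<not> \<nu> \<le> N"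
    hence "x N \<le> x (\<nu> - 1)" by (intro mono) simp
    thus False using x\<nu> N u by simp
  qed
  have xdiff: "x (N - 1) - real i * h = x (N - 1 - i)" if "i < N" for i
    using that N by (simp add: x_def of_nat_diff algebra_simps)
  have sm: "summable f" unfolding f_def using N h by (intro summable_ln_coth_lattice) auto
  define d where "d = - x (\<nu> - 1)"
  have d: "0 < d" "d \<le> h" using x\<nu> \<nu>0 by (auto simp: d_def x_def of_nat_diff algebra_simps)
  have \<nu>d: "real \<nu> = (c - d) / h + 1 / 2" using \<nu>0 h by (simp add: d_def x_def of_nat_diff field_simps)
  have e1: "0 < 1 - exp (- h)" using h by simp
  have "(\<Sum>i. f (i + (N - \<nu>))) \<le> real \<nu> * ln_coth u"
  proof -
    have "f (i + (N - \<nu>)) = ln_coth (u + d + real i * h)" for i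
    proof -
      have "u - x (N - 1) + real (i + (N - \<nu>)) * h = u + d + real i * h"
        using \<nu>0 N \<open>\<nu> \<le> N\<close> by (simp add: d_def x_def of_nat_diff algebra_simps)
      thus ?thesis unfolding f_def by (simp only:)
    qed
    hence "(\<Sum>i. f (i + (N - \<nu>))) \<le> ln_coth (u + d) / (1 - exp (- h))"
      using summable_ln_coth_lattice(2)[of "u + d" h] u d h by simp
    also have "\<dots> \<le> exp (- d) * ln_coth u / (1 - exp (- h))"
      using ln_coth_add_le[of u d] u d e1 by (intro divide_right_mono) auto
    also have "\<dots> = exp (- d) / (1 - exp (- h)) * ln_coth u" by simp
    also have "\<dots> \<le> real \<nu> * ln_coth u"
    proof (intro mult_right_mono ln_coth_nonneg u)
      \<comment> \<open>The chord bound makes the tail coefficient affine in the overhang d, with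
        slope -1/h. The exact value of \<nu> has the same slope in d, so the assumption on c settles
        all d at once.\<close>
      have "exp (- d) / (1 - exp (- h)) \<le> (1 - d / h * (1 - exp (- h))) / (1 - exp (- h))"
        using exp_neg_le_chord[of h d] h d e1 by (intro divide_right_mono) auto
      also have "\<dots> = 1 / (1 - exp (- h)) - d / h" using e1 by (simp add: diff_divide_distrib)
      also have "\<dots> \<le> real \<nu>" using c \<nu>d h by (simp add: diff_divide_distrib)
      finally show "exp (- d) / (1 - exp (- h)) \<le> real \<nu>" .
    qed
    finally show ?thesis .
  qed
  moreover have "(\<Sum>i<N - \<nu>. f i) = (\<Sum>j\<in>{\<nu>..<N}. ln_coth (u - max 0 (x j)))"
  proof (rule sum.reindex_bij_witness[of _ "\<lambda>j. N - 1 - j" "\<lambda>i. N - 1 - i"])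
    fix i assume i: "i \<in> {..<N - \<nu>}"
    hence "x \<nu> \<le> x (N - 1 - i)" by (intro mono) auto
    hence "max 0 (x (N - 1 - i)) = x (N - 1 - i)" using x\<nu> by simp
    moreover have "u - x (N - 1 - i) = u - x (N - 1) + real i * h" using xdiff[of i] i by (auto simp: algebra_simps)
    ultimately show "ln_coth (u - max 0 (x (N - 1 - i))) = f i" by (simp only: f_def)
  qed auto
  moreover have "(\<Sum>j<\<nu>. ln_coth (u - max 0 (x j))) = real \<nu> * ln_coth u"
  proof -
    have "max 0 (x j) = 0" if "j < \<nu>" for j
      using order_le_less_trans[OF mono[of j "\<nu> - 1"] x\<nu>(2)] that by simp
    thus ?thesis by simp
  qed
  moreover have "(\<Sum>j<N. ln_coth (u - max 0 (x j))) = (\<Sum>j<\<nu>. ln_coth (u - max 0 (x j))) + (\<Sum>j\<in>{\<nu>..<N}. ln_coth (u - max 0 (x j)))"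
    using \<open>\<nu> \<le> N\<close> by (simp add: lessThan_atLeast0 sum.atLeastLessThan_concat)
  ultimately show ?thesis
    using suminf_split_initial_segment[OF sm, of "N - \<nu>"] unfolding f_def by linarith
qed

text \<open>The one-sided comparison is applied to the points left of u and, after the reflection t
  -> L - t, to those right of u. The relation between k, h, L and c makes the lattice symmetric
  under this reflection, with index j going to k - 1 - j.\<close>

lemma sum_ln_coth_clamped_lattice_ge:
  fixes h c L u :: real and k :: nat
  defines "a \<equiv> \<lambda>j. max 0 (min L ((real j + 1 / 2) * h - c))"
  assumes h: "h > 0" and L: "0 \<le> L" "real k * h = L + 2 * c"
    and c: "1 / (1 - exp (- h)) \<le> c / h + 1 / 2" "h < 2 * c"
    and u: "0 \<le> u" "u \<le> L" "\<And>j. j < k \<Longrightarrow> u \<noteq> a j"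
  shows "pi\<^sup>2 / (2 * h) - ln 2 \<le> (\<Sum>j<k. ln_coth \<bar>u - a j\<bar>)"
proof -
  define x where "x j = (real j + 1 / 2) * h - c" for j
  have x_refl: "x (k - 1 - j) = L - x j" if "j < k" for j
    using that L by (simp add: x_def of_nat_diff algebra_simps)
  define N where "N = nat \<lceil>(u + c) / h - 1 / 2\<rceil>"
  have k0: "k > 0" using L c h by (cases "k = 0") auto
  have "(u + c) / h - 1 / 2 > 0" using c h u by (simp add: field_simps)
  hence N0: "N > 0" and rN: "(u + c) / h - 1 / 2 \<le> real N" "real N < (u + c) / h - 1 / 2 + 1"
    unfolding N_def by linarith+
  have xN: "x (N - 1) < u" "u \<le> x N"
    using rN N0 h by (auto simp: x_def of_nat_diff field_simps)
  have mono: "x i \<le> x j" if "i \<le> j" for i j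
    unfolding x_def using that h by (simp add: mult_right_mono)
  have xk: "x (k - 1) > L" using L c k0 h by (simp add: x_def of_nat_diff algebra_simps)
  have "N < k"
  proof (rule ccontr)
    assume "\<not> N < k"
    hence "x (k - 1) \<le> x (N - 1)" by (intro mono) simp
    thus False using xk xN u by simp
  qed
  have x0: "x 0 < 0" using c by (simp add: x_def)
  \<comment> \<open>The first lattice point is clamped to 0 and the last one to L, so avoiding all
    nodes puts u strictly inside the interval, as the one-sided comparison requires on both
    sides.\<close>
  have "u \<noteq> 0" using u(3)[OF k0] x0 L by (simp add: a_def x_def min_def)
  hence u0: "u > 0" using u by simp
  have "u \<noteq> L" using u(3)[of "k - 1"] k0 xk L by (simp add: a_def x_def[symmetric])
  hence uL: "u < L" using u by simp
  have "u \<noteq> x N" using u(3)[OF \<open>N < k\<close>] u by (auto simp: a_def x_def[symmetric])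
  hence xN': "u < x N" using xN by simp
  have "(\<Sum>i. ln_coth (u - x (N - 1) + real i * h)) \<le> (\<Sum>j<N. ln_coth (u - max 0 (x j)))"
    unfolding x_def
    by (rule sum_ln_coth_clamped_ge[OF h N0 _ _ u0 c]) (use xN in \<open>simp_all add: x_def\<close>)
  also have "\<dots> = (\<Sum>j<N. ln_coth \<bar>u - a j\<bar>)"
  proof (intro sum.cong refl)
    fix j assume "j \<in> {..<N}"
    hence "x j \<le> x (N - 1)" by (intro mono) auto
    thus "ln_coth (u - max 0 (x j)) = ln_coth \<bar>u - a j\<bar>" using xN u by (simp add: a_def x_def[symmetric])
  qed
  finally have left: "(\<Sum>i. ln_coth (u - x (N - 1) + real i * h)) \<le> (\<Sum>j<N. ln_coth \<bar>u - a j\<bar>)" .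
  have r1: "x (k - N - 1) = L - x N" using x_refl[of N] \<open>N < k\<close> by (simp add: diff_diff_add add.commute)
  have r2: "x (k - N) = L - x (N - 1)" using x_refl[of "N - 1"] \<open>N < k\<close> N0 by (simp add: Suc_diff_Suc)
  have "(\<Sum>i. ln_coth ((L - u) - x (k - N - 1) + real i * h)) \<le> (\<Sum>j<k - N. ln_coth ((L - u) - max 0 (x j)))"
    unfolding x_def
    by (rule sum_ln_coth_clamped_ge[OF h _ _ _ _ c], unfold x_def[symmetric] r1 r2)
      (use xN xN' uL \<open>N < k\<close> in auto)
  \<comment> \<open>The two one-sided series have complementary offsets, summing to h: together they
    form the full lattice seen from u.\<close>
  also have "(L - u) - x (k - N - 1) = h - (u - x (N - 1))"
    unfolding r1 using N0 by (simp add: x_def of_nat_diff algebra_simps)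
  also have "(\<Sum>j<k - N. ln_coth ((L - u) - max 0 (x j))) = (\<Sum>j\<in>{N..<k}. ln_coth \<bar>u - a j\<bar>)"
  proof (rule sum.reindex_bij_witness[of _ "\<lambda>j. k - 1 - j" "\<lambda>i. k - 1 - i"])
    fix j assume j: "j \<in> {..<k - N}"
    hence "x j \<le> x (k - N - 1)" by (intro mono) auto
    hence "x j < L - u" using r1 xN' by simp
    moreover have "a (k - 1 - j) = max 0 (min L (L - x j))"
      using x_refl[of j] j by (simp add: a_def x_def[symmetric])
    ultimately show "ln_coth \<bar>u - a (k - 1 - j)\<bar> = ln_coth (L - u - max 0 (x j))"
      using u by (auto simp: max_def min_def abs_if diff_diff_eq add.commute)
  qed auto
  finally have right: "(\<Sum>i. ln_coth (h - (u - x (N - 1)) + real i * h)) \<le> (\<Sum>j\<in>{N..<k}. ln_coth \<bar>u - a j\<bar>)" .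
  have "x N = x (N - 1) + h" using N0 by (simp add: x_def of_nat_diff algebra_simps)
  hence "pi\<^sup>2 / (2 * h) - ln 2 \<le> (\<Sum>i. ln_coth (u - x (N - 1) + real i * h)) + (\<Sum>i. ln_coth (h - (u - x (N - 1)) + real i * h))"
    using xN xN' by (intro suminf_ln_coth_lattice_ge[OF h]) auto
  also have "\<dots> \<le> (\<Sum>j<N. ln_coth \<bar>u - a j\<bar>) + (\<Sum>j\<in>{N..<k}. ln_coth \<bar>u - a j\<bar>)"
    using left right by simp
  also have "\<dots> = (\<Sum>j<k. ln_coth \<bar>u - a j\<bar>)"
    using \<open>N < k\<close> by (simp add: lessThan_atLeast0 sum.atLeastLessThan_concat)
  finally show ?thesis .
qed

text \<open>Dividing numerator and denominator by the larger exponential gives tanh(|u - a|/2). This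
  turns the product of factors into a sum of \<open>ln_coth\<close>.\<close>

lemma abs_diff_div_add_exp:
  assumes "u \<noteq> a"
  shows "\<bar>(exp u - exp a) / (exp u + exp a)\<bar> = exp (- ln_coth \<bar>u - a\<bar>)"
proof -
  have *: "\<bar>(exp u - exp a) / (exp u + exp a)\<bar> = exp (- ln_coth \<bar>u - a\<bar>)" if "a < u" for u a :: real
  proof -
    have "exp (- ln_coth (u - a)) = inverse ((1 + exp (a - u)) / (1 - exp (a - u)))"
      using that by (simp add: ln_coth_def exp_minus add_pos_pos)
    also have "exp (a - u) = exp a / exp u" by (rule exp_diff)
    also have "inverse ((1 + exp a / exp u) / (1 - exp a / exp u)) = (exp u - exp a) / (exp u + exp a)"
    proof -
      have "1 + exp a / exp u = (exp u + exp a) / exp u" "1 - exp a / exp u = (exp u - exp a) / exp u"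
        by (simp_all add: field_simps)
      thus ?thesis by simp
    qed
    finally show ?thesis using that by (simp add: add_pos_pos)
  qed
  show ?thesis
  proof (cases "a < u")
    case False
    hence "u < a" using assms by simp
    from *[OF this] show ?thesis by (simp add: abs_minus_commute add.commute abs_divide)
  qed (rule *)
qed

text \<open>In the coordinate u = ln x, k equally spaced points fill an interval of length L' that
  overhangs [0, ln R] by c >= ln 16 on each side. The points p j are the exponentials of the clamped
  lattice; the spacing h = L'/k turns pi^2 / (2 h) into the exponent of the claim.\<close>

lemma exists_small_quotient_on_interval:
  fixes R L' :: real and k :: nat
  assumes R: "R \<ge> 1" and k: "k > 0" and L': "L' \<ge> ln R + 2 * ln 16" and small: "exp (- (pi\<^sup>2 * real k / (2 * L'))) < 1 / 4"
  shows "\<exists>p. (\<forall>j<k. p j > 0) \<and>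
    (\<forall>x\<in>{1..R}. (\<Prod>j<k. \<bar>x - p j\<bar> / (x + p j)) \<le> 2 * exp (- (pi\<^sup>2 * real k / (2 * L'))))"
proof -
  define L c h where "L = ln R" and "c = (L' - L) / 2" and "h = L' / real k"
  have ln2: "2 / 3 \<le> ln (2::real)" by (rule ln2_ge_two_thirds)
  have ln16: "ln (16::real) = 4 * ln 2" using ln_realpow[of "2::real" 4] by simp
  have L0: "L \<ge> 0" using R by (simp add: L_def)
  have c: "c \<ge> 8 / 3" using L' ln16 ln2 by (simp add: c_def L_def)
  have L'0: "L' > 0" using c L0 by (simp add: c_def)
  have h: "h > 0" using L'0 k by (simp add: h_def)
  have e: "pi\<^sup>2 * real k / (2 * L') = pi\<^sup>2 / (2 * h)" using k L'0 by (simp add: h_def)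
  \<comment> \<open>The smallness assumption bounds the spacing: pi^2 / (2 h) > 2 ln 2 >= 4/3, hence
    h < 3 pi^2 / 8 < 4.\<close>
  have "exp (- (pi\<^sup>2 / (2 * h))) < exp (- (2 * ln 2))"
    using small unfolding e by (simp add: exp_minus exp_double)
  hence "2 * ln 2 < pi\<^sup>2 / (2 * h)" by simp
  hence "4 / 3 < pi\<^sup>2 / (2 * h)" using ln2 by linarith
  hence "8 / 3 * h < pi\<^sup>2" using h by (simp add: field_simps)
  moreover have "pi\<^sup>2 \<le> (3.15)\<^sup>2" using pi_approx by (intro power_mono) auto
  ultimately have h_less: "h < 4" by (simp add: power2_eq_square)
  \<comment> \<open>Subtracting 1 turns the left side into 1 / (exp h - 1). With exp h - 1 >= h +
    h^2/2 the claim reduces to 1 <= (c - h/2) (1 + h/2), which follows from c >= 8/3 and h <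
    4.\<close>
  have "1 / (1 - exp (- h)) \<le> c / h + 1 / 2"
  proof -
    have "h + h\<^sup>2 / 2 \<le> exp h - 1" using exp_lower_Taylor_quadratic[of h] h by simp
    moreover have "0 < h + h\<^sup>2 / 2" using h by (simp add: add_pos_pos)
    ultimately have "1 / (exp h - 1) \<le> 1 / (h + h\<^sup>2 / 2)" using h by (intro divide_left_mono mult_pos_pos) auto
    also have "\<dots> \<le> c / h - 1 / 2"
    proof -
      have "0 \<le> h * (4 - h)" using h h_less by simp
      with h_less have "1 \<le> (8 / 3 - h / 2) * (1 + h / 2)" by (simp add: algebra_simps)
      also have "\<dots> \<le> (c - h / 2) * (1 + h / 2)" using c h by (intro mult_right_mono) auto
      finally have "1 / (1 + h / 2) \<le> c - h / 2" using h by (simp add: divide_le_eq)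
      hence "1 / (1 + h / 2) / h \<le> (c - h / 2) / h" using h by (intro divide_right_mono) auto
      moreover have "1 / (1 + h / 2) / h = 1 / (h + h\<^sup>2 / 2)" by (simp add: power2_eq_square algebra_simps)
      ultimately show ?thesis using h by (simp add: diff_divide_distrib)
    qed
    also have "1 / (exp h - 1) = 1 / (1 - exp (- h)) - 1" using h by (simp add: exp_minus field_simps)
    finally show ?thesis by simp
  qed
  moreover have "h < 2 * c" using c h_less by simp
  moreover have "real k * h = L + 2 * c" using k by (simp add: h_def c_def field_simps)
  ultimately have main: "pi\<^sup>2 / (2 * h) - ln 2 \<le> (\<Sum>j<k. ln_coth \<bar>u - max 0 (min L ((real j + 1 / 2) * h - c))\<bar>)"
    if "0 \<le> u" "u \<le> L" "\<And>j. j < k \<Longrightarrow> u \<noteq> max 0 (min L ((real j + 1 / 2) * h - c))" for u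
    using sum_ln_coth_clamped_lattice_ge[OF h L0, of k c u] that by blast
  define a where "a j = max 0 (min L ((real j + 1 / 2) * h - c))" for j
  have "(\<Prod>j<k. \<bar>x - exp (a j)\<bar> / (x + exp (a j))) \<le> 2 * exp (- (pi\<^sup>2 / (2 * h)))" if x: "x \<in> {1..R}" for x
  proof -
    define u where "u = ln x"
    have xu: "x = exp u" and u: "0 \<le> u" "u \<le> L" using x by (auto simp: u_def L_def)
    show ?thesis
    proof (cases "\<exists>j<k. u = a j")
      case True
      hence "\<exists>j\<in>{..<k}. \<bar>x - exp (a j)\<bar> / (x + exp (a j)) = 0" by (auto simp: xu)
      hence "(\<Prod>j<k. \<bar>x - exp (a j)\<bar> / (x + exp (a j))) = 0" by (intro prod_zero) auto
      thus ?thesis by (simp only:) simp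
    next
      case False
      hence "(\<Prod>j<k. \<bar>x - exp (a j)\<bar> / (x + exp (a j))) = (\<Prod>j<k. exp (- ln_coth \<bar>u - a j\<bar>))"
      proof (intro prod.cong refl)
        fix j assume "j \<in> {..<k}"
        with False have "u \<noteq> a j" by auto
        from abs_diff_div_add_exp[OF this]
        show "\<bar>x - exp (a j)\<bar> / (x + exp (a j)) = exp (- ln_coth \<bar>u - a j\<bar>)"
          by (simp add: xu abs_divide add_pos_pos)
      qed
      also have "\<dots> = exp (- (\<Sum>j<k. ln_coth \<bar>u - a j\<bar>))" by (simp add: exp_sum sum_negf[symmetric])
      also have "\<dots> \<le> exp (ln 2 - pi\<^sup>2 / (2 * h))" using main[OF u] False unfolding a_def by force
      also have "\<dots> = 2 * exp (- (pi\<^sup>2 / (2 * h)))" using exp_add[of "ln 2" "- (pi\<^sup>2 / (2 * h))"] by simp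
      finally show ?thesis .
    qed
  qed
  thus ?thesis unfolding e by (intro exI[of _ "\<lambda>j. exp (a j)"]) auto
qed

section \<open>Diagonalization and singular values\<close>

lemma scalar_prod_ge_0_real: "(v :: real vec) \<bullet> v \<ge> 0"
  unfolding scalar_prod_def by (intro sum_nonneg) auto

lemma scalar_prod_eq_0_real:
  assumes "v \<in> carrier_vec n" "(v :: real vec) \<bullet> v = 0"
  shows "v = 0\<^sub>v n"
  using assms by (auto simp: scalar_prod_def sum_nonneg_eq_0_iff)

lemma scalar_prod_pos_real:
  assumes "v \<in> carrier_vec n" "v \<noteq> 0\<^sub>v n"
  shows "(v :: real vec) \<bullet> v > 0"
  using scalar_prod_eq_0_real[OF assms(1)] scalar_prod_ge_0_real[of v] assms(2) by fastforce

lemma symmetric_scalar_prod: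
  fixes A :: "real mat"
  assumes A: "A \<in> carrier_mat n n" "A\<^sup>T = A" and v: "v \<in> carrier_vec n" "w \<in> carrier_vec n"
  shows "(A *\<^sub>v v) \<bullet> w = v \<bullet> (A *\<^sub>v w)"
  using transpose_vec_mult_scalar[OF A(1) v(2,1)] A v
  by (metis comm_scalar_prod mult_mat_vec_carrier)

text \<open>Split a complex eigenvector into p + i q. Symmetry of the form on p and q forces Im l
  times (|p|^2 + |q|^2) to vanish, so l is real and whichever of p, q is nonzero is a real
  eigenvector.\<close>

lemma symmetric_real_eigenvector:
  fixes A :: "real mat"
  assumes A: "A \<in> carrier_mat n n" and sym: "A\<^sup>T = A" and n: "n > 0"
  shows "\<exists>e v. v \<in> carrier_vec n \<and> v \<bullet> v = 1 \<and> A *\<^sub>v v = e \<cdot>\<^sub>v v"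
proof -
  define C where "C = map_mat complex_of_real A"
  have C: "C \<in> carrier_mat n n" using A by (simp add: C_def)
  from spectrum_non_empty[OF C n] obtain l where "eigenvalue C l" by (auto simp: spectrum_def)
  then obtain z where z: "z \<in> carrier_vec n" "z \<noteq> 0\<^sub>v n" "C *\<^sub>v z = l \<cdot>\<^sub>v z"
    using C by (auto simp: eigenvalue_def eigenvector_def)
  define p q where "p = map_vec Re z" and "q = map_vec Im z"
  have p: "p \<in> carrier_vec n" and q: "q \<in> carrier_vec n" using z by (auto simp: p_def q_def)
  have Cz: "(C *\<^sub>v z) $ i = Complex ((A *\<^sub>v p) $ i) ((A *\<^sub>v q) $ i)" if "i < n" for i
    using that A z(1) by (auto simp: C_def p_def q_def scalar_prod_def complex_eq_iff Re_sum Im_sum)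
  have Ap: "A *\<^sub>v p = Re l \<cdot>\<^sub>v p - Im l \<cdot>\<^sub>v q"
  proof (rule eq_vecI)
    fix i assume "i < dim_vec (Re l \<cdot>\<^sub>v p - Im l \<cdot>\<^sub>v q)"
    hence i: "i < n" using q by auto
    have "(A *\<^sub>v p) $ i = Re ((l \<cdot>\<^sub>v z) $ i)" using Cz[OF i] z(3) by simp
    thus "(A *\<^sub>v p) $ i = (Re l \<cdot>\<^sub>v p - Im l \<cdot>\<^sub>v q) $ i" using i z(1) by (simp add: p_def q_def)
  qed (use A q in auto)
  have Aq: "A *\<^sub>v q = Im l \<cdot>\<^sub>v p + Re l \<cdot>\<^sub>v q"
  proof (rule eq_vecI)
    fix i assume "i < dim_vec (Im l \<cdot>\<^sub>v p + Re l \<cdot>\<^sub>v q)"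
    hence i: "i < n" using q by auto
    have "(A *\<^sub>v q) $ i = Im ((l \<cdot>\<^sub>v z) $ i)" using Cz[OF i] z(3) by simp
    thus "(A *\<^sub>v q) $ i = (Im l \<cdot>\<^sub>v p + Re l \<cdot>\<^sub>v q) $ i" using i z(1) by (simp add: p_def q_def)
  qed (use A q in auto)
  have pq: "p \<noteq> 0\<^sub>v n \<or> q \<noteq> 0\<^sub>v n"
  proof (rule ccontr)
    assume *: "\<not> ?thesis"
    have "z = 0\<^sub>v n"
    proof (rule eq_vecI)
      fix i assume "i < dim_vec (0\<^sub>v n)"
      moreover from this have "p $ i = 0" "q $ i = 0" using * by auto
      ultimately show "z $ i = 0\<^sub>v n $ i" using z(1) by (auto simp: p_def q_def complex_eq_iff)
    qed (use z in auto)
    with z(2) show False by simp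
  qed
  have "(A *\<^sub>v p) \<bullet> q = p \<bullet> (A *\<^sub>v q)" by (rule symmetric_scalar_prod[OF A sym p q])
  moreover have "(A *\<^sub>v p) \<bullet> q = Re l * (p \<bullet> q) - Im l * (q \<bullet> q)"
    unfolding Ap using p q by (subst minus_scalar_prod_distrib[of _ n]) auto
  moreover have "p \<bullet> (A *\<^sub>v q) = Im l * (p \<bullet> p) + Re l * (p \<bullet> q)"
    unfolding Aq using p q by (subst scalar_prod_add_distrib[of _ n]) auto
  ultimately have "Im l * (p \<bullet> p + q \<bullet> q) = 0" by (simp add: algebra_simps)
  moreover have "p \<bullet> p + q \<bullet> q > 0"
    using pq scalar_prod_pos_real[OF p] scalar_prod_pos_real[OF q] scalar_prod_ge_0_real[of p] scalar_prod_ge_0_real[of q]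
    by fastforce
  ultimately have l: "Im l = 0" by simp
  have "A *\<^sub>v p = Re l \<cdot>\<^sub>v p" "A *\<^sub>v q = Re l \<cdot>\<^sub>v q" unfolding Ap Aq l using p q by auto
  with pq p q obtain w where w: "w \<in> carrier_vec n" "w \<noteq> 0\<^sub>v n" "A *\<^sub>v w = Re l \<cdot>\<^sub>v w" by blast
  define v where "v = (1 / sqrt (w \<bullet> w)) \<cdot>\<^sub>v w"
  have ww: "w \<bullet> w > 0" by (rule scalar_prod_pos_real[OF w(1,2)])
  have "v \<bullet> v = 1" using w ww by (simp add: v_def)
  moreover have "A *\<^sub>v v = Re l \<cdot>\<^sub>v v" unfolding v_def using w A by (simp add: mult_mat_vec smult_smult_assoc mult.commute)
  ultimately show ?thesis using w by (intro exI[of _ "Re l"] exI[of _ v]) (auto simp: v_def)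
qed

text \<open>The Householder reflection along w = v - e_0. Since |v| = 1, t = |w|^2 = 2 - 2 v_0, so
  w_0 = -t/2, which makes column 0 equal to e_0 + w = v. For v = e_0 the identity serves.\<close>

lemma exists_reflection_to_unit_vector:
  fixes v :: "real vec"
  assumes v: "v \<in> carrier_vec n" "v \<bullet> v = 1" and n: "n > 0"
  shows "\<exists>W \<in> carrier_mat n n. W\<^sup>T = W \<and> W * W = 1\<^sub>m n \<and> col W 0 = v"
proof (cases "v = unit_vec n 0")
  case True
  thus ?thesis using n by (intro bexI[of _ "1\<^sub>m n"]) auto
next
  case False
  define w where "w = v - unit_vec n 0"
  have w: "w \<in> carrier_vec n" using v by (simp add: w_def)
  define t where "t = w \<bullet> w"
  have "w \<noteq> 0\<^sub>v n"
  proof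
    assume *: "w = 0\<^sub>v n"
    have "v = unit_vec n 0"
    proof (rule eq_vecI)
      fix i assume "i < dim_vec (unit_vec n 0 :: real vec)"
      hence "i < n" by simp
      thus "v $ i = unit_vec n 0 $ i" using arg_cong[OF *, of "\<lambda>x. x $ i"] v by (simp add: w_def)
    qed (use v in auto)
    with False show False by simp
  qed
  hence t: "t > 0" unfolding t_def by (rule scalar_prod_pos_real[OF w])
  have tv: "t = 2 - 2 * v $ 0"
  proof -
    have "t = v \<bullet> v - v \<bullet> unit_vec n 0 - (unit_vec n 0 \<bullet> v - unit_vec n 0 \<bullet> unit_vec n 0)"
      unfolding t_def w_def using v
      by (simp add: minus_scalar_prod_distrib[of _ n] scalar_prod_minus_distrib[of _ n])
    thus ?thesis using v n by simp
  qed
  define W where "W = mat n n (\<lambda>(i,j). (if i = j then 1 else 0) - 2 / t * (w $ i * w $ j))"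
  have W: "W \<in> carrier_mat n n" by (simp add: W_def)
  have "W\<^sup>T = W" by (rule eq_matI) (auto simp: W_def)
  moreover have "W * W = 1\<^sub>m n"
  proof (rule eq_matI)
    fix i j assume "i < dim_row (1\<^sub>m n :: real mat)" "j < dim_col (1\<^sub>m n :: real mat)"
    hence ij: "i < n" "j < n" by auto
    have "(W * W) $$ (i,j) = (\<Sum>k<n. ((if i = k then 1 else 0) - 2 / t * (w $ i * w $ k)) * ((if k = j then 1 else 0) - 2 / t * (w $ k * w $ j)))"
      using ij by (auto simp: W_def scalar_prod_def lessThan_atLeast0)
    also have "\<dots> = (\<Sum>k<n. (if i = k then if i = j then 1 else 0 else 0) - (if i = k then 2 / t * (w $ i * w $ j) else 0)
        - (if k = j then 2 / t * (w $ i * w $ j) else 0) + (2 / t)\<^sup>2 * w $ i * w $ j * (w $ k * w $ k))"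
      by (intro sum.cong refl) (auto simp: algebra_simps power2_eq_square)
    also have "\<dots> = (if i = j then 1 else 0) - 2 / t * (w $ i * w $ j) - 2 / t * (w $ i * w $ j) + (2 / t)\<^sup>2 * w $ i * w $ j * (\<Sum>k<n. w $ k * w $ k)"
      using ij by (simp add: sum.distrib sum_subtractf sum_distrib_left)
    also have "(\<Sum>k<n. w $ k * w $ k) = t" using w by (simp add: t_def scalar_prod_def lessThan_atLeast0)
    finally show "(W * W) $$ (i,j) = 1\<^sub>m n $$ (i,j)" using ij t by (simp add: power2_eq_square)
  qed (auto simp: W_def)
  moreover have "col W 0 = v"
  proof (rule eq_vecI)
    fix i assume "i < dim_vec v"
    hence i: "i < n" using v by simp
    have "w $ 0 = - t / 2" using n v tv by (simp add: w_def)
    thus "col W 0 $ i = v $ i" using i n t v by (auto simp: W_def w_def)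
  qed (use v in \<open>auto simp: W_def\<close>)
  ultimately show ?thesis using W by blast
qed

text \<open>Deflation by induction on the size: conjugating with a reflection that sends e_0 to an
  eigenvector clears column 0 below the diagonal, and by symmetry row 0 as well. The remaining block
  is symmetric of size n.\<close>

lemma symmetric_diagonalization:
  fixes A :: "real mat"
  assumes "A \<in> carrier_mat n n" "A\<^sup>T = A"
  shows "\<exists>U d. U \<in> carrier_mat n n \<and> U\<^sup>T * U = 1\<^sub>m n \<and> A = U * mat_diag n d * U\<^sup>T"
  using assms
proof (induction n arbitrary: A)
  case 0
  thus ?case by (intro exI[of _ "1\<^sub>m 0"]) (auto intro!: eq_matI)
next
  case (Suc n A)
  note A = Suc.prems
  obtain e v where v: "v \<in> carrier_vec (Suc n)" "v \<bullet> v = 1" "A *\<^sub>v v = e \<cdot>\<^sub>v v"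
    using symmetric_real_eigenvector[OF A] by auto
  obtain W where W: "W \<in> carrier_mat (Suc n) (Suc n)" "W\<^sup>T = W" "W * W = 1\<^sub>m (Suc n)" "col W 0 = v"
    using exists_reflection_to_unit_vector[OF v(1,2)] by auto
  define B where "B = W * A * W"
  have B: "B \<in> carrier_mat (Suc n) (Suc n)" using W A by (simp add: B_def)
  have Bsym: "B\<^sup>T = B" unfolding B_def using W A
    by (simp add: transpose_mult[of _ "Suc n" "Suc n" _ "Suc n"])
  have "col B 0 = (W * A) *\<^sub>v v" unfolding B_def using W A by (subst col_mult2[of _ "Suc n" "Suc n" _ "Suc n"]) auto
  also have "\<dots> = e \<cdot>\<^sub>v (W *\<^sub>v v)" using W A v by (simp add: mult_mat_vec)
  also have "W *\<^sub>v v = col (W * W) 0" using W by (subst col_mult2[of _ "Suc n" "Suc n" _ "Suc n"]) auto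
  finally have B0: "col B 0 = e \<cdot>\<^sub>v unit_vec (Suc n) 0" using W by simp
  have Bi0: "B $$ (i, 0) = (if i = 0 then e else 0)" if "i < Suc n" for i
    using arg_cong[OF B0, of "\<lambda>x. x $ i"] that B by (auto split: if_splits)
  have B0i: "B $$ (0, i) = (if i = 0 then e else 0)" if "i < Suc n" for i
  proof -
    have "B\<^sup>T $$ (i, 0) = B $$ (0, i)" using that B by simp
    thus ?thesis using Bi0[OF that] Bsym by simp
  qed
  define A' where "A' = mat n n (\<lambda>(i,j). B $$ (Suc i, Suc j))"
  have A': "A' \<in> carrier_mat n n" by (simp add: A'_def)
  have "A'\<^sup>T = A'"
  proof (rule eq_matI)
    fix i j assume "i < dim_row A'" "j < dim_col A'"
    hence ij: "i < n" "j < n" by (auto simp: A'_def)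
    have "B\<^sup>T $$ (Suc i, Suc j) = B $$ (Suc j, Suc i)" using ij B by simp
    thus "A'\<^sup>T $$ (i,j) = A' $$ (i,j)" using ij Bsym by (simp add: A'_def)
  qed (auto simp: A'_def)
  from Suc.IH[OF A' this] obtain U d where U: "U \<in> carrier_mat n n" "U\<^sup>T * U = 1\<^sub>m n" "A' = U * mat_diag n d * U\<^sup>T"
    by blast
  let ?E = "mat 1 1 (\<lambda>_. e)"
  have Bblock: "B = four_block_mat ?E (0\<^sub>m 1 n) (0\<^sub>m n 1) A'"
    using B by (intro eq_matI) (auto simp: A'_def Bi0 B0i)
  define V where "V = four_block_mat (1\<^sub>m 1) (0\<^sub>m 1 n) (0\<^sub>m n 1) U"
  define d' where "d' i = (if i = 0 then e else d (i - 1))" for i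
  have V: "V \<in> carrier_mat (Suc n) (Suc n)" unfolding V_def using four_block_carrier_mat[of "1\<^sub>m 1" 1 1 U n n] U by simp
  have VT: "V\<^sup>T = four_block_mat (1\<^sub>m 1) (0\<^sub>m 1 n) (0\<^sub>m n 1) U\<^sup>T"
    unfolding V_def using U by (subst transpose_four_block_mat) auto
  have D: "mat_diag (Suc n) d' = four_block_mat ?E (0\<^sub>m 1 n) (0\<^sub>m n 1) (mat_diag n d)"
    by (intro eq_matI) (auto simp: mat_diag_def d'_def)
  have "V\<^sup>T * V = four_block_mat (1\<^sub>m 1) (0\<^sub>m 1 n) (0\<^sub>m n 1) (1\<^sub>m n)"
    unfolding VT unfolding V_def using U
    by (subst mult_four_block_mat[of _ 1 1 _ n _ n _ _ 1 _ n]) auto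
  hence VV: "V\<^sup>T * V = 1\<^sub>m (Suc n)" by simp
  have "V * mat_diag (Suc n) d' = four_block_mat ?E (0\<^sub>m 1 n) (0\<^sub>m n 1) (U * mat_diag n d)"
    unfolding D V_def using U left_mult_zero_mat[OF mat_diag_dim, of 1 n d]
    by (subst mult_four_block_mat[of _ 1 1 _ n _ n _ _ 1 _ n]) auto
  hence "V * mat_diag (Suc n) d' * V\<^sup>T = four_block_mat ?E (0\<^sub>m 1 n) (0\<^sub>m n 1) (U * mat_diag n d * U\<^sup>T)"
    unfolding VT using U mult_carrier_mat[OF mult_carrier_mat[OF U(1) mat_diag_dim[of n d]], of "U\<^sup>T" n] right_mult_zero_mat[of "U * mat_diag n d" n n 1]
      left_add_zero_mat[of "U * mat_diag n d * U\<^sup>T" n n]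
    by (simp add: mult_four_block_mat[of _ 1 1 _ n _ n _ _ 1 _ n])
  hence BV: "V * mat_diag (Suc n) d' * V\<^sup>T = B" using Bblock U(3) by simp
  let ?D = "mat_diag (Suc n) d'"
  have T: "(W * V)\<^sup>T = V\<^sup>T * W" using W V by (simp add: transpose_mult[of _ "Suc n" "Suc n" _ "Suc n"])
  have cD: "?D \<in> carrier_mat (Suc n) (Suc n)" by simp
  have cVT: "V\<^sup>T \<in> carrier_mat (Suc n) (Suc n)" using V by simp
  note cs = W(1) V cVT cD A(1) B
  note assoc = assoc_mult_mat[of _ "Suc n" "Suc n" _ "Suc n" _ "Suc n"] mult_carrier_mat[of _ "Suc n" "Suc n" _ "Suc n"]
  have "(W * V)\<^sup>T * (W * V) = V\<^sup>T * (W * W) * V" unfolding T using cs by (simp add: assoc)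
  hence "(W * V)\<^sup>T * (W * V) = 1\<^sub>m (Suc n)" using W V VV by simp
  moreover have "(W * V) * ?D * (W * V)\<^sup>T = A"
  proof -
    have "(W * V) * ?D * (W * V)\<^sup>T = W * (V * ?D * V\<^sup>T) * W" unfolding T using cs by (simp add: assoc)
    also have "\<dots> = (W * W) * A * (W * W)" unfolding BV B_def using cs by (simp add: assoc)
    finally show ?thesis using W A by simp
  qed
  moreover have "W * V \<in> carrier_mat (Suc n) (Suc n)" using cs by simp
  ultimately show ?case by metis
qed

section \<open>Singular values and linear constraints\<close>

text \<open>A homogeneous system with more unknowns than equations, solved by Gaussian elimination:
  a nonzero coefficient in equation b serves as pivot to eliminate one unknown from the
  others.\<close>

lemma exists_nontrivial_relation:
  fixes G :: "'b \<Rightarrow> 'k \<Rightarrow> real"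
  assumes "finite B" "finite K" "card B < card K"
  shows "\<exists>c. (\<exists>k\<in>K. c k \<noteq> 0) \<and> (\<forall>b\<in>B. (\<Sum>k\<in>K. c k * G b k) = 0)"
  using assms
proof (induction B arbitrary: K G rule: finite_induct)
  case empty
  thus ?case by (intro exI[of _ "\<lambda>_. 1"]) (auto simp: card_gt_0_iff)
next
  case (insert b B K G)
  show ?case
  proof (cases "\<forall>k\<in>K. G b k = 0")
    case True
    thus ?thesis using insert.IH[of K G] insert.prems insert.hyps by force
  next
    case False
    then obtain k0 where k0: "k0 \<in> K" "G b k0 \<noteq> 0" by blast
    define K' where "K' = K - {k0}"
    have K': "finite K'" "card B < card K'" "K = insert k0 K'" "k0 \<notin> K'"
      using insert.prems insert.hyps k0 by (auto simp: K'_def)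
    obtain c where c: "\<exists>k\<in>K'. c k \<noteq> 0"
      "\<forall>b'\<in>B. (\<Sum>k\<in>K'. c k * (G b' k - G b' k0 * G b k / G b k0)) = 0"
      using insert.IH[OF K'(1,2), of "\<lambda>b' k. G b' k - G b' k0 * G b k / G b k0"] by auto
    define c' where "c' k = (if k = k0 then - (\<Sum>k\<in>K'. c k * G b k) / G b k0 else c k)" for k
    have sum: "(\<Sum>k\<in>K. c' k * G b' k) = (\<Sum>k\<in>K'. c k * (G b' k - G b' k0 * G b k / G b k0))" for b'
    proof -
      have "(\<Sum>k\<in>K'. c' k * G b' k) = (\<Sum>k\<in>K'. c k * G b' k)"
        using K' by (intro sum.cong) (auto simp: c'_def)
      hence "(\<Sum>k\<in>K. c' k * G b' k) = (\<Sum>k\<in>K'. c k * G b' k) - (\<Sum>k\<in>K'. c k * G b k) / G b k0 * G b' k0"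
        unfolding K'(3) using K'(1,4) by (simp add: c'_def)
      thus ?thesis by (simp add: sum_subtractf sum_divide_distrib sum_distrib_left sum_distrib_right algebra_simps)
    qed
    show ?thesis
    proof (intro exI conjI ballI)
      show "\<exists>k\<in>K. c' k \<noteq> 0" using c(1) K' by (auto simp: c'_def)
      fix b' assume "b' \<in> insert b B"
      thus "(\<Sum>k\<in>K. c' k * G b' k) = 0" unfolding sum using c(2) k0 by auto
    qed
  qed
qed

text \<open>Links \<open>singular_values\<close>, defined through roots of a characteristic
  polynomial, with any orthogonal diagonalization: similar matrices share that polynomial, and the
  diagonal one splits into linear factors.\<close>

lemma singular_values_diagonalization:
  assumes M: "M \<in> carrier_mat nr nc" and U: "U \<in> carrier_mat nc nc" "U\<^sup>T * U = 1\<^sub>m nc"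
    and D: "M\<^sup>T * M = U * mat_diag nc d * U\<^sup>T"
  shows "singular_values M = map sqrt (rev (sort (map d [0..<nc])))"
proof -
  have UU: "U * U\<^sup>T = 1\<^sub>m nc" using U by (intro mat_mult_left_right_inverse[of "U\<^sup>T"]) auto
  have "similar_mat (M\<^sup>T * M) (mat_diag nc d)"
    unfolding similar_mat_def similar_mat_wit_def using M U D UU by (intro exI[of _ U] exI[of _ "U\<^sup>T"]) (auto simp: Let_def)
  hence "char_poly (M\<^sup>T * M) = char_poly (mat_diag nc d)" by (rule char_poly_similar)
  also have "\<dots> = (\<Prod>a\<leftarrow>diag_mat (mat_diag nc d). [:- a, 1:])"
    by (rule char_poly_upper_triangular[of _ nc]) (auto simp: mat_diag_def)
  also have "diag_mat (mat_diag nc d) = map d [0..<nc]"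
    unfolding diag_mat_def by (auto simp: mat_diag_def)
  finally have cp: "char_poly (M\<^sup>T * M) = (\<Prod>a\<leftarrow>map d [0..<nc]. [:- a, 1:])" .
  have "proots (\<Prod>a\<leftarrow>xs. [:- a, 1:]) = mset xs" for xs :: "real list"
  proof (induction xs)
    case (Cons a xs)
    have "(\<Prod>a\<leftarrow>xs. [:- a, 1:]) \<noteq> 0" by (auto simp: prod_list_zero_iff)
    hence "proots ([:- a, 1:] * (\<Prod>a\<leftarrow>xs. [:- a, 1:])) = proots [:- a, 1:] + proots (\<Prod>a\<leftarrow>xs. [:- a, 1:])"
      by (intro proots_mult) auto
    thus ?case using Cons by (simp del: mult_pCons_left)
  qed simp
  hence "proots (char_poly (M\<^sup>T * M)) = mset (map d [0..<nc])" unfolding cp by blast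
  thus ?thesis unfolding singular_values_def by (simp only: sorted_list_of_multiset_mset)
qed

lemma mult_isometry_scalar_prod:
  fixes U :: "real mat"
  assumes U: "U \<in> carrier_mat nr nc" "U\<^sup>T * U = 1\<^sub>m nc" and x: "x \<in> carrier_vec nc" "y \<in> carrier_vec nc"
  shows "(U *\<^sub>v x) \<bullet> (U *\<^sub>v y) = x \<bullet> y"
proof -
  have "(U *\<^sub>v x) \<bullet> (U *\<^sub>v y) = (U *\<^sub>v y) \<bullet> (U *\<^sub>v x)" using U x by (intro comm_scalar_prod[of _ nr]) auto
  also have "\<dots> = (U\<^sup>T *\<^sub>v (U *\<^sub>v y)) \<bullet> x" using transpose_vec_mult_scalar[OF U(1) x(1), of "U *\<^sub>v y"] U x by auto
  also have "U\<^sup>T *\<^sub>v (U *\<^sub>v y) = (U\<^sup>T * U) *\<^sub>v y"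
    using assoc_mult_mat_vec[of "U\<^sup>T" nc nr U nc y] U(1) x by simp
  finally show ?thesis using U x by (simp add: comm_scalar_prod[of y nc])
qed

text \<open>One half of the Courant--Fischer principle, with the subspace given by linear constraints.\<close>

lemma sigma_le_if_bounded_on_constraints:
  fixes M :: "real mat" and g :: "'b \<Rightarrow> real vec"
  assumes M: "M \<in> carrier_mat nr nc" and B: "finite B" "card B \<le> r"
    and g: "\<And>b. b \<in> B \<Longrightarrow> g b \<in> carrier_vec nc" and s: "s \<ge> 0"
    and le: "\<And>v. v \<in> carrier_vec nc \<Longrightarrow> (\<And>b. b \<in> B \<Longrightarrow> g b \<bullet> v = 0) \<Longrightarrow> (M *\<^sub>v v) \<bullet> (M *\<^sub>v v) \<le> s\<^sup>2 * (v \<bullet> v)"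
  shows "sigma (r + 1) M \<le> s"
proof (rule ccontr)
  assume "\<not> sigma (r + 1) M \<le> s"
  hence gt: "sigma (r + 1) M > s" by simp
  let ?S = "M\<^sup>T * M"
  have S: "?S \<in> carrier_mat nc nc" using M by simp
  have "?S\<^sup>T = ?S" using M by (simp add: transpose_mult[of _ nc nr])
  from symmetric_diagonalization[OF S this] obtain U d where
    U: "U \<in> carrier_mat nc nc" "U\<^sup>T * U = 1\<^sub>m nc" and D: "?S = U * mat_diag nc d * U\<^sup>T" by blast
  define xs where "xs = rev (sort (map d [0..<nc]))"
  have sv: "singular_values M = map sqrt xs" unfolding xs_def by (rule singular_values_diagonalization[OF M U D])
  \<comment> \<open>Beyond the list \<open>sigma\<close> takes the default value 0, which cannot
    exceed s >= 0, so the index r is in range.\<close>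
  have r: "r < length xs" and "s < sqrt (xs ! r)"
    using gt s unfolding sigma_def sv by (auto split: if_splits)
  hence xr: "s\<^sup>2 < xs ! r" using s real_sqrt_gt_0_iff[of "xs ! r"]
    by (smt (verit) real_sqrt_pow2 power_strict_mono zero_less_numeral)
  \<comment> \<open>By the descending order at least r + 1 eigenvalues of the Gram matrix exceed
    s^2. With at most r constraints, some nonzero combination of their eigenvectors satisfies all of
    them, and on it the quadratic form exceeds the assumed bound.\<close>
  define I where "I = {i. i < nc \<and> s\<^sup>2 < d i}"
  have "r < card {i. i < length xs \<and> s\<^sup>2 < xs ! i}"
  proof -
    have "s\<^sup>2 < xs ! i" if "i \<le> r" for i
    proof -
      have "sorted_wrt (\<ge>) xs" unfolding xs_def by (simp add: sorted_wrt_rev)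
      hence "xs ! r \<le> xs ! i" using that r by (cases "i = r") (auto simp: sorted_wrt_iff_nth_less)
      thus ?thesis using xr by simp
    qed
    hence "{..r} \<subseteq> {i. i < length xs \<and> s\<^sup>2 < xs ! i}" using r by auto
    from card_mono[OF _ this] show ?thesis by simp
  qed
  also have "\<dots> = length (filter (\<lambda>x. s\<^sup>2 < x) xs)" by (simp add: length_filter_conv_card)
  also have "\<dots> = size (filter_mset (\<lambda>x. s\<^sup>2 < x) (mset xs))" by (metis mset_filter size_mset)
  also have "mset xs = mset (map d [0..<nc])" by (simp add: xs_def)
  also have "size (filter_mset (\<lambda>x. s\<^sup>2 < x) (mset (map d [0..<nc]))) = length (filter (\<lambda>x. s\<^sup>2 < x) (map d [0..<nc]))"
    by (metis mset_filter size_mset)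
  also have "\<dots> = card I" unfolding length_filter_conv_card I_def by (intro arg_cong[of _ _ card]) auto
  finally have cI: "card B < card I" using B by simp
  have finI: "finite I" by (simp add: I_def)
  obtain c where c: "\<exists>i\<in>I. c i \<noteq> 0" "\<forall>b\<in>B. (\<Sum>i\<in>I. c i * (g b \<bullet> col U i)) = 0"
    using exists_nontrivial_relation[OF B(1) finI cI, of "\<lambda>b i. g b \<bullet> col U i"] by blast
  define y where "y = vec nc (\<lambda>i. if i \<in> I then c i else 0)"
  have y: "y \<in> carrier_vec nc" by (simp add: y_def)
  define v where "v = U *\<^sub>v y"
  have v: "v \<in> carrier_vec nc" using U y by (simp add: v_def)
  have "g b \<bullet> v = 0" if b: "b \<in> B" for b
  proof -
    have "g b \<bullet> v = (U\<^sup>T *\<^sub>v g b) \<bullet> y" unfolding v_def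
      using transpose_vec_mult_scalar[OF U(1) y g[OF b]] by simp
    also have "\<dots> = (\<Sum>i<nc. if i \<in> I then c i * (g b \<bullet> col U i) else 0)"
    proof -
      have "(U\<^sup>T *\<^sub>v g b) $ i = g b \<bullet> col U i" if "i < nc" for i
        using that U(1) g[OF b] by (simp add: comm_scalar_prod[of "g b" nc])
      thus ?thesis unfolding scalar_prod_def[of _ y] lessThan_atLeast0 by (intro sum.cong) (auto simp: y_def)
    qed
    also have "\<dots> = (\<Sum>i\<in>I. c i * (g b \<bullet> col U i))"
      by (subst sum.inter_restrict[symmetric]) (auto simp: I_def intro!: sum.cong)
    finally show ?thesis using c b by simp
  qed
  from le[OF v this] have "(M *\<^sub>v v) \<bullet> (M *\<^sub>v v) \<le> s\<^sup>2 * (v \<bullet> v)" by blast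
  moreover have "v \<bullet> v = y \<bullet> y" unfolding v_def using U y by (intro mult_isometry_scalar_prod) auto
  moreover have "(M *\<^sub>v v) \<bullet> (M *\<^sub>v v) = y \<bullet> (mat_diag nc d *\<^sub>v y)"
  proof -
    have "(M *\<^sub>v v) \<bullet> (M *\<^sub>v v) = (M\<^sup>T *\<^sub>v (M *\<^sub>v v)) \<bullet> v"
      using transpose_vec_mult_scalar[OF M v, of "M *\<^sub>v v"] M v by auto
    also have "M\<^sup>T *\<^sub>v (M *\<^sub>v v) = ?S *\<^sub>v v" using M v by (simp add: assoc_mult_mat_vec[of _ nc nr _ nc])
    also have "\<dots> = U *\<^sub>v (mat_diag nc d *\<^sub>v (U\<^sup>T *\<^sub>v (U *\<^sub>v y)))"
      unfolding D v_def using U y by (simp add: assoc_mult_mat_vec[of _ nc nc _ nc])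
    also have "U\<^sup>T *\<^sub>v (U *\<^sub>v y) = (U\<^sup>T * U) *\<^sub>v y"
      using assoc_mult_mat_vec[of "U\<^sup>T" nc nc U nc y] U(1) y by simp
    also have "\<dots> = y" using U y by simp
    also have "(U *\<^sub>v (mat_diag nc d *\<^sub>v y)) \<bullet> v = (mat_diag nc d *\<^sub>v y) \<bullet> y"
      unfolding v_def using U y mult_mat_vec_carrier[OF mat_diag_dim y] by (intro mult_isometry_scalar_prod) auto
    also have "\<dots> = y \<bullet> (mat_diag nc d *\<^sub>v y)" using y mult_mat_vec_carrier[OF mat_diag_dim y] by (intro comm_scalar_prod[of _ nc]) auto
    finally show ?thesis .
  qed
  moreover have "s\<^sup>2 * (y \<bullet> y) < y \<bullet> (mat_diag nc d *\<^sub>v y)"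
  proof -
    have dy: "(mat_diag nc d *\<^sub>v y) $ i = d i * y $ i" if "i < nc" for i
    proof -
      have "(mat_diag nc d *\<^sub>v y) $ i = (\<Sum>j\<in>{0..<nc}. (if i = j then d j else 0) * y $ j)"
        using that y by (simp add: mat_diag_def scalar_prod_def)
      also have "\<dots> = (\<Sum>j\<in>{0..<nc}. if i = j then d j * y $ j else 0)" by (intro sum.cong) auto
      finally show ?thesis using that by simp
    qed
    have "s\<^sup>2 * (y \<bullet> y) = (\<Sum>i\<in>{0..<nc}. s\<^sup>2 * (y $ i * y $ i))" using y by (simp add: scalar_prod_def sum_distrib_left)
    also have "\<dots> < (\<Sum>i\<in>{0..<nc}. d i * (y $ i * y $ i))"
    proof (rule sum_strict_mono_ex1)
      show "\<forall>i\<in>{0..<nc}. s\<^sup>2 * (y $ i * y $ i) \<le> d i * (y $ i * y $ i)"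
        by (auto simp: y_def I_def intro!: mult_right_mono)
      from c obtain i where i: "i \<in> I" "c i \<noteq> 0" by blast
      moreover have "0 < c i * c i" using i by (simp flip: power2_eq_square)
      ultimately have "s\<^sup>2 * (y $ i * y $ i) < d i * (y $ i * y $ i)" "i \<in> {0..<nc}"
        by (auto simp: y_def I_def intro!: mult_strict_right_mono)
      thus "\<exists>i\<in>{0..<nc}. s\<^sup>2 * (y $ i * y $ i) < d i * (y $ i * y $ i)" by blast
    qed simp
    also have "\<dots> = y \<bullet> (mat_diag nc d *\<^sub>v y)" using dy
      by (auto simp: scalar_prod_def mat_diag_def intro!: sum.cong)
    finally show ?thesis .
  qed
  ultimately show False by simp
qed

section \<open>Functions of a symmetric matrix\<close>

text \<open>Functional calculus indexed by the position of the eigenvector: for A =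
  \<open>spectral_mat U d\<close>, a function f of A is
  \<open>spectral_mat U (\<lambda>i. f (d i))\<close>. Sums, products and norms reduce to pointwise
  statements on f.\<close>

definition spectral_mat :: "real mat \<Rightarrow> (nat \<Rightarrow> real) \<Rightarrow> real mat" where
  "spectral_mat U f = U * mat_diag (dim_row U) f * U\<^sup>T"

context
  fixes U :: "real mat" and n :: nat
  assumes U: "U \<in> carrier_mat n n" and UU: "U\<^sup>T * U = 1\<^sub>m n"
begin

lemma orthogonal_right_inverse: "U * U\<^sup>T = 1\<^sub>m n"
  using U UU by (intro mat_mult_left_right_inverse[of "U\<^sup>T"]) auto

lemma spectral_mat_carrier [simp]: "spectral_mat U f \<in> carrier_mat n n"
  using U mult_carrier_mat[OF mult_carrier_mat[OF U mat_diag_dim], of "U\<^sup>T" n] by (simp add: spectral_mat_def)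

lemma spectral_mat_index:
  assumes "i < n" "j < n"
  shows "spectral_mat U f $$ (i,j) = (\<Sum>k<n. f k * (U $$ (i,k) * U $$ (j,k)))"
proof -
  have "U * mat_diag n f = mat n n (\<lambda>(i,j). U $$ (i,j) * f j)" by (rule mat_diag_mult_right[OF U])
  thus ?thesis using assms U
    by (auto simp: spectral_mat_def scalar_prod_def lessThan_atLeast0 mult_ac intro!: sum.cong)
qed

lemma transpose_spectral_mat: "(spectral_mat U f)\<^sup>T = spectral_mat U f"
proof (rule eq_matI)
  fix i j assume "i < dim_row (spectral_mat U f)" "j < dim_col (spectral_mat U f)"
  hence ij: "i < n" "j < n" using carrier_matD[OF spectral_mat_carrier[of f]] by auto
  thus "(spectral_mat U f)\<^sup>T $$ (i,j) = spectral_mat U f $$ (i,j)"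
    using carrier_matD[OF spectral_mat_carrier[of f]] by (simp add: spectral_mat_index mult_ac)
qed (use carrier_matD[OF spectral_mat_carrier[of f]] in auto)

lemma spectral_mat_mult: "spectral_mat U f * spectral_mat U g = spectral_mat U (\<lambda>i. f i * g i)"
proof -
  note assoc = assoc_mult_mat[of _ n n _ n _ n] mult_carrier_mat[of _ n n _ n]
  have UT: "U\<^sup>T \<in> carrier_mat n n" using U by simp
  have "spectral_mat U f * spectral_mat U g = U * mat_diag n f * (U\<^sup>T * U) * mat_diag n g * U\<^sup>T"
    using U UT by (simp add: spectral_mat_def assoc del: mat_diag_diag)
  also have "\<dots> = U * (mat_diag n f * mat_diag n g) * U\<^sup>T"
    unfolding UU using U UT by (simp add: assoc left_mult_one_mat[of _ n n] del: mat_diag_diag)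
  finally show ?thesis using U by (simp add: spectral_mat_def)
qed

lemma spectral_mat_add: "spectral_mat U f + spectral_mat U g = spectral_mat U (\<lambda>i. f i + g i)"
  by (rule eq_matI) (use carrier_matD[OF spectral_mat_carrier] in \<open>auto simp: spectral_mat_index sum.distrib algebra_simps\<close>)

lemma spectral_mat_diff: "spectral_mat U f - spectral_mat U g = spectral_mat U (\<lambda>i. f i - g i)"
  by (rule eq_matI) (use carrier_matD[OF spectral_mat_carrier] in \<open>auto simp: spectral_mat_index sum_subtractf algebra_simps\<close>)

lemma spectral_mat_smult: "c \<cdot>\<^sub>m spectral_mat U f = spectral_mat U (\<lambda>i. c * f i)"
  by (rule eq_matI) (use carrier_matD[OF spectral_mat_carrier] in \<open>auto simp: spectral_mat_index sum_distrib_left algebra_simps\<close>)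

lemma spectral_mat_one: "spectral_mat U (\<lambda>_. 1) = 1\<^sub>m n"
  using U orthogonal_right_inverse by (simp add: spectral_mat_def)

lemma spectral_mat_cong: "(\<And>i. i < n \<Longrightarrow> f i = g i) \<Longrightarrow> spectral_mat U f = spectral_mat U g"
  by (rule eq_matI) (use carrier_matD[OF spectral_mat_carrier] in \<open>auto simp: spectral_mat_index intro!: sum.cong\<close>)

lemma spectral_mat_mult_col:
  assumes "i < n"
  shows "spectral_mat U f *\<^sub>v col U i = f i \<cdot>\<^sub>v col U i"
proof -
  have Ui: "U\<^sup>T *\<^sub>v col U i = unit_vec n i"
    using col_mult2[of "U\<^sup>T" n n U n i] U UU assms by simp
  have "spectral_mat U f *\<^sub>v col U i = (U * mat_diag n f) *\<^sub>v (U\<^sup>T *\<^sub>v col U i)"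
    unfolding spectral_mat_def using U assoc_mult_mat_vec[OF mult_carrier_mat[OF U mat_diag_dim[of n f]], of "U\<^sup>T" n "col U i"]
      col_dim[of U i] by (simp del: col_dim)
  also have "\<dots> = col (U * mat_diag n f) i"
  proof -
    have "M *\<^sub>v unit_vec n i = col M i" if "M \<in> carrier_mat n n" for M :: "real mat"
      using that assms by (intro eq_vecI) auto
    thus ?thesis unfolding Ui using mult_carrier_mat[OF U mat_diag_dim[of n f]] by blast
  qed
  also have "\<dots> = f i \<cdot>\<^sub>v col U i"
    unfolding mat_diag_mult_right[OF U] using assms U by (intro eq_vecI) auto
  finally show ?thesis .
qed

lemma spectral_mat_mult_vec_index:
  assumes "x \<in> carrier_vec n" "i < n"
  shows "(spectral_mat U f *\<^sub>v x) $ i = (\<Sum>k<n. f k * U $$ (i,k) * (col U k \<bullet> x))"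
proof -
  have "(spectral_mat U f *\<^sub>v x) $ i = (\<Sum>j<n. (\<Sum>k<n. f k * (U $$ (i,k) * U $$ (j,k))) * x $ j)"
    using assms carrier_matD[OF spectral_mat_carrier[of f]]
    by (auto simp: scalar_prod_def lessThan_atLeast0 spectral_mat_index[unfolded lessThan_atLeast0] intro!: sum.cong)
  also have "\<dots> = (\<Sum>k<n. \<Sum>j<n. f k * (U $$ (i,k) * U $$ (j,k)) * x $ j)"
    unfolding sum_distrib_right by (rule sum.swap)
  also have "\<dots> = (\<Sum>k<n. f k * U $$ (i,k) * (col U k \<bullet> x))"
    using assms U by (auto simp: scalar_prod_def lessThan_atLeast0 sum_distrib_left mult_ac intro!: sum.cong)
  finally show ?thesis .
qed

lemma spectral_mat_quadratic_form:
  assumes x: "x \<in> carrier_vec n"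
  shows "x \<bullet> (spectral_mat U f *\<^sub>v x) = (\<Sum>k<n. f k * (col U k \<bullet> x)\<^sup>2)"
proof -
  have "x \<bullet> (spectral_mat U f *\<^sub>v x) = (\<Sum>i<n. x $ i * (spectral_mat U f *\<^sub>v x) $ i)"
    using carrier_matD[OF spectral_mat_carrier[of f]]
    by (simp add: scalar_prod_def[of x] lessThan_atLeast0 del: index_mult_mat_vec)
  also have "\<dots> = (\<Sum>i<n. x $ i * (\<Sum>k<n. f k * U $$ (i,k) * (col U k \<bullet> x)))"
    by (intro sum.cong) (auto simp: spectral_mat_mult_vec_index[OF x] simp del: index_mult_mat_vec)
  also have "\<dots> = (\<Sum>k<n. \<Sum>i<n. x $ i * (f k * U $$ (i,k) * (col U k \<bullet> x)))"
    unfolding sum_distrib_left by (rule sum.swap)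
  also have "\<dots> = (\<Sum>k<n. f k * (col U k \<bullet> x)\<^sup>2)"
  proof (intro sum.cong refl)
    fix k assume "k \<in> {..<n}"
    hence "col U k \<bullet> x = (\<Sum>i<n. x $ i * U $$ (i,k))"
      using x U by (auto simp: scalar_prod_def lessThan_atLeast0 mult.commute intro!: sum.cong)
    thus "(\<Sum>i<n. x $ i * (f k * U $$ (i,k) * (col U k \<bullet> x))) = f k * (col U k \<bullet> x)\<^sup>2"
      by (simp add: power2_eq_square sum_distrib_left sum_distrib_right mult_ac)
  qed
  finally show ?thesis .
qed

lemma spectral_mat_norm_le:
  assumes x: "x \<in> carrier_vec n" and f: "\<And>i. i < n \<Longrightarrow> \<bar>f i\<bar> \<le> s"
  shows "(spectral_mat U f *\<^sub>v x) \<bullet> (spectral_mat U f *\<^sub>v x) \<le> s\<^sup>2 * (x \<bullet> x)"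
proof -
  let ?F = "spectral_mat U f"
  have "(?F *\<^sub>v x) \<bullet> (?F *\<^sub>v x) = x \<bullet> (?F *\<^sub>v (?F *\<^sub>v x))"
    by (rule symmetric_scalar_prod[OF _ transpose_spectral_mat x]) (use mult_mat_vec_carrier[OF spectral_mat_carrier x] in auto)
  also have "?F *\<^sub>v (?F *\<^sub>v x) = spectral_mat U (\<lambda>i. f i * f i) *\<^sub>v x"
    using assoc_mult_mat_vec[of ?F n n ?F n x] x by (simp add: spectral_mat_mult)
  also have "x \<bullet> \<dots> = (\<Sum>k<n. f k * f k * (col U k \<bullet> x)\<^sup>2)" by (rule spectral_mat_quadratic_form[OF x])
  also have "\<dots> \<le> (\<Sum>k<n. s\<^sup>2 * (col U k \<bullet> x)\<^sup>2)"
  proof (intro sum_mono mult_right_mono)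
    fix k assume "k \<in> {..<n}"
    hence "\<bar>f k\<bar>\<^sup>2 \<le> s\<^sup>2" using f by (intro power_mono) auto
    thus "f k * f k \<le> s\<^sup>2" by (simp add: power2_eq_square)
  qed auto
  also have "\<dots> = s\<^sup>2 * (x \<bullet> (spectral_mat U (\<lambda>_. 1) *\<^sub>v x))"
    unfolding spectral_mat_quadratic_form[OF x] by (simp add: sum_distrib_left)
  finally show ?thesis using x by (simp add: spectral_mat_one)
qed

lemma spectral_mat_pos_def:
  assumes x: "x \<in> carrier_vec n" and f: "\<And>i. i < n \<Longrightarrow> f i > 0" and 0: "x \<bullet> (spectral_mat U f *\<^sub>v x) = 0"
  shows "x = 0\<^sub>v n"
proof -
  have "\<forall>k\<in>{..<n}. f k * (col U k \<bullet> x)\<^sup>2 = 0"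
    using 0 f unfolding spectral_mat_quadratic_form[OF x] by (subst (asm) sum_nonneg_eq_0_iff) (auto simp: less_imp_le)
  hence "(col U k \<bullet> x)\<^sup>2 = 0" if "k < n" for k using f that by force
  hence "x \<bullet> (spectral_mat U (\<lambda>_. 1) *\<^sub>v x) = 0" unfolding spectral_mat_quadratic_form[OF x] by simp
  thus ?thesis using x by (simp add: spectral_mat_one scalar_prod_eq_0_real)
qed

lemma eigenvalue_spectral_mat: "i < n \<Longrightarrow> eigenvalue (spectral_mat U f) (f i)"
proof -
  assume i: "i < n"
  have "col U i \<bullet> col U i = (U\<^sup>T * U) $$ (i,i)" using i U by simp
  hence "col U i \<bullet> col U i = 1" using UU i by simp
  hence "col U i \<noteq> 0\<^sub>v n" by auto
  thus ?thesis using spectral_mat_mult_col[OF i, of f] i U carrier_matD[OF spectral_mat_carrier[of f]]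
    unfolding eigenvalue_def eigenvector_def by (intro exI[of _ "col U i"]) auto
qed

end

section \<open>The projector onto the negative eigenspace\<close>

text \<open>A projector fixes its range, so Q P = P and P Q = Q; transposing the first identity
  gives P = P Q.\<close>

lemma is_orth_projector_unique:
  assumes "is_orth_projector n P S" "is_orth_projector n Q S"
  shows "P = Q"
proof -
  have absorb: "Q * P = P" if PS: "is_orth_projector n P S" and QS: "is_orth_projector n Q S" for P Q
  proof (rule eq_matI)
    have P: "P \<in> carrier_mat n n" and Q: "Q \<in> carrier_mat n n" "Q * Q = Q"
      using PS QS by (auto simp: is_orth_projector_def)
    fix i j assume ij: "i < dim_row P" "j < dim_col P"
    hence j: "j < n" using P by simp
    have "col P j = P *\<^sub>v unit_vec n j" using P j by (intro eq_vecI) auto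
    hence "col P j \<in> S" using PS unfolding is_orth_projector_def by auto
    then obtain x where x: "x \<in> carrier_vec n" "col P j = Q *\<^sub>v x" using QS unfolding is_orth_projector_def by auto
    have "Q *\<^sub>v (Q *\<^sub>v x) = (Q * Q) *\<^sub>v x" using assoc_mult_mat_vec[OF Q(1) Q(1) x(1)] by simp
    hence "Q *\<^sub>v col P j = col P j" using Q(2) x(2) by simp
    hence "col (Q * P) j = col P j" using col_mult2[OF Q(1) P j] by (simp only:)
    thus "(Q * P) $$ (i,j) = P $$ (i,j)" using ij P Q by (metis carrier_matD index_col index_mult_mat(2,3))
  qed (use PS QS in \<open>auto simp: is_orth_projector_def\<close>)
  have P: "P \<in> carrier_mat n n" "P\<^sup>T = P" and Q: "Q \<in> carrier_mat n n" "Q\<^sup>T = Q"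
    using assms by (auto simp: is_orth_projector_def)
  have "P = (Q * P)\<^sup>T" using absorb[OF assms] P by simp
  also have "\<dots> = P * Q" using P Q by (simp add: transpose_mult[of _ n n _ n])
  also have "\<dots> = Q" by (rule absorb[OF assms(2,1)])
  finally show ?thesis .
qed

text \<open>The indicator of the negative eigenvalues yields a symmetric idempotent; showing that
  its range is the span of the negative eigenvectors lets uniqueness resolve the definite
  description.\<close>

lemma Pi_neg_spectral_mat:
  assumes U: "U \<in> carrier_mat n n" "U\<^sup>T * U = 1\<^sub>m n"
  shows "Pi_neg (spectral_mat U d) = spectral_mat U (\<lambda>i. if d i < 0 then 1 else 0)"
proof -
  let ?A = "spectral_mat U d" and ?f = "\<lambda>i. if d i < 0 then 1 else 0 :: real"
  let ?P = "spectral_mat U ?f"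
  interpret vec_space "TYPE(real)" n .
  note car = spectral_mat_carrier[OF U]
  have A: "?A \<in> carrier_mat n n" and P: "?P \<in> carrier_mat n n" by (rule car)+
  define E where "E = {v. \<exists>e::real. e < 0 \<and> eigenvector ?A v e}"
  have E: "E \<subseteq> carrier_vec n" using A by (auto simp: E_def eigenvector_def)
  have "neg_eigenspace ?A = span E" unfolding neg_eigenspace_def E_def using A by simp
  moreover have "(\<lambda>x. ?P *\<^sub>v x) ` carrier_vec n = span E"
  proof
    show "(\<lambda>x. ?P *\<^sub>v x) ` carrier_vec n \<subseteq> span E"
    proof
      fix y assume "y \<in> (\<lambda>x. ?P *\<^sub>v x) ` carrier_vec n"
      then obtain x where x: "x \<in> carrier_vec n" and y: "y = ?P *\<^sub>v x" by blast
      define t where "t k = (?f k * (col U k \<bullet> x)) \<cdot>\<^sub>v col U k" for k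
      have t: "t k \<in> carrier_vec n" for k using U by (auto simp: t_def)
      have "t k \<in> span E" if k: "k < n" for k
      proof (cases "d k < 0")
        case True
        have "col U k \<bullet> col U k = (U\<^sup>T * U) $$ (k,k)" using k U(1) by simp
        hence "col U k \<bullet> col U k = 1" using U(2) k by simp
        hence "col U k \<noteq> 0\<^sub>v n" by auto
        hence "col U k \<in> E"
          using spectral_mat_mult_col[OF U k, of d] U(1) A True unfolding E_def eigenvector_def
          by (intro CollectI exI[of _ "d k"]) auto
        hence "col U k \<in> span E" using in_own_span[of E] E by auto
        thus ?thesis unfolding t_def by (rule smult_in_span[OF E])
      next
        case False
        hence "t k = 0\<^sub>v n" using U(1) by (auto simp: t_def)
        thus ?thesis using span_zero by simp
      qed
      hence "sumlist (map t [0..<n]) \<in> span E" using E by (intro sumlist_in_span) auto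
      moreover have "sumlist (map t [0..<n]) = y"
      proof (rule eq_vecI)
        fix i assume "i < dim_vec y"
        hence i: "i < n" using y P by simp
        have "sumlist (map t [0..<n]) $ i = (\<Sum>k<n. t k $ i)"
          using i t by (subst sumlist_nth) (auto simp: carrier_vecD[OF t] lessThan_atLeast0 intro!: sum.cong)
        also have "\<dots> = y $ i" unfolding y spectral_mat_mult_vec_index[OF U x i]
          using i U(1) by (intro sum.cong) (auto simp: t_def)
        finally show "sumlist (map t [0..<n]) $ i = y $ i" .
      qed (use y P carrier_vecD[OF t] in \<open>auto simp: dim_sumlist\<close>)
      ultimately show "y \<in> span E" by simp
    qed
    \<comment> \<open>The fixed vectors of \<open>?P\<close> form a subspace, so to place the whole
      span inside the range it is enough to treat single eigenvectors.\<close>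
    define N where "N = {v \<in> carrier_vec n. ?P *\<^sub>v v = v}"
    have "submodule class_ring N V"
    proof (rule submodule.intro)
      show "module class_ring V" by unfold_locales
    qed (use P in \<open>auto simp: N_def module_vec_simps class_ring_simps mult_add_distrib_mat_vec[OF P] mult_mat_vec[OF P]\<close>)
    moreover have "E \<subseteq> N"
    proof
      fix v assume "v \<in> E"
      then obtain e where v: "v \<in> carrier_vec n" and e: "e < 0" and Av: "?A *\<^sub>v v = e \<cdot>\<^sub>v v"
        using A unfolding E_def eigenvector_def by auto
      \<comment> \<open>An eigenvector for e < 0 is orthogonal to every column of U whose eigenvalue
        differs from e, so only columns with negative \<open>d k\<close> contribute.\<close>
      have "?f k * U $$ (i,k) * (col U k \<bullet> v) = 1 * U $$ (i,k) * (col U k \<bullet> v)" if k: "k < n" for i k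
      proof (cases "col U k \<bullet> v = 0")
        case False
        have ck: "col U k \<in> carrier_vec n" using U(1) by auto
        have "(?A *\<^sub>v col U k) \<bullet> v = col U k \<bullet> (?A *\<^sub>v v)"
          by (rule symmetric_scalar_prod[OF A transpose_spectral_mat[OF U] ck v])
        hence "d k * (col U k \<bullet> v) = e * (col U k \<bullet> v)"
          unfolding Av spectral_mat_mult_col[OF U k] using ck v by simp
        thus ?thesis using False e by simp
      qed simp
      hence "(?P *\<^sub>v v) $ i = (spectral_mat U (\<lambda>_. 1) *\<^sub>v v) $ i" if "i < n" for i
        unfolding spectral_mat_mult_vec_index[OF U v that] by (intro sum.cong) auto
      hence "?P *\<^sub>v v = spectral_mat U (\<lambda>_. 1) *\<^sub>v v" using P car[of "\<lambda>_. 1"] by (intro eq_vecI) auto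
      thus "v \<in> N" using v by (simp add: N_def spectral_mat_one[OF U])
    qed
    ultimately have "span E \<subseteq> N" by (intro span_is_subset)
    moreover have "v \<in> (\<lambda>x. ?P *\<^sub>v x) ` carrier_vec n" if "v \<in> N" for v
      using that unfolding N_def by (intro image_eqI[of _ _ v]) auto
    ultimately show "span E \<subseteq> (\<lambda>x. ?P *\<^sub>v x) ` carrier_vec n" by (meson subset_iff)
  qed
  ultimately have "is_orth_projector n ?P (neg_eigenspace ?A)"
    unfolding is_orth_projector_def using P transpose_spectral_mat[OF U] spectral_mat_mult[OF U]
    by (auto intro!: spectral_mat_cong[OF U])
  moreover from this have "Q = ?P" if "is_orth_projector n Q (neg_eigenspace ?A)" for Q
    using is_orth_projector_unique[OF that] by simp
  moreover have "dim_row ?A = n" using A by simp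
  ultimately show ?thesis unfolding Pi_neg_def by (metis (no_types, lifting) the_equality)
qed

lemma has_bandwidth_mult:
  assumes "A \<in> carrier_mat n n" "B \<in> carrier_mat n n" "has_bandwidth A a" "has_bandwidth B b"
  shows "has_bandwidth (A * B) (a + b)"
  unfolding has_bandwidth_def
proof (intro allI impI)
  fix i j assume ij: "i < dim_row (A * B)" "j < dim_col (A * B)" and far: "a + b < nat \<bar>int i - int j\<bar>"
  have "A $$ (i,k) * B $$ (k,j) = 0" if "k < n" for k
  proof -
    have "a < nat \<bar>int i - int k\<bar> \<or> b < nat \<bar>int k - int j\<bar>" using far by linarith
    thus ?thesis using assms ij that unfolding has_bandwidth_def by auto
  qed
  thus "(A * B) $$ (i,j) = 0" using assms ij by (auto simp: scalar_prod_def intro!: sum.neutral)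
qed

section \<open>Banded matrices and off-diagonal blocks\<close>

text \<open>Each linear factor in A adds b to the bandwidth. The scalar c is used with the values 1
  and -1, for q(A) and q(-A).\<close>

lemma has_bandwidth_spectral_mat_prod:
  assumes U: "U \<in> carrier_mat n n" "U\<^sup>T * U = 1\<^sub>m n" and b: "has_bandwidth (spectral_mat U d) b"
  shows "has_bandwidth (spectral_mat U (\<lambda>i. \<Prod>j<k. c * d i + p j)) (k * b)"
proof (induction k)
  case 0
  show ?case using spectral_mat_one[OF U] by (auto simp: has_bandwidth_def)
next
  case (Suc k)
  note car = spectral_mat_carrier[OF U]
  have "spectral_mat U (\<lambda>i. c * d i + p k) = c \<cdot>\<^sub>m spectral_mat U d + p k \<cdot>\<^sub>m 1\<^sub>m n"
    by (simp add: spectral_mat_smult[OF U] spectral_mat_add[OF U] spectral_mat_one[OF U, symmetric])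
  hence "has_bandwidth (spectral_mat U (\<lambda>i. c * d i + p k)) b"
    using b carrier_matD[OF car[of d]] unfolding has_bandwidth_def by auto
  from has_bandwidth_mult[OF car car Suc.IH this]
  show ?case unfolding spectral_mat_mult[OF U] by (simp add: add.commute)
qed

lemma has_bandwidth_add:
  "A \<in> carrier_mat n n \<Longrightarrow> B \<in> carrier_mat n n \<Longrightarrow> has_bandwidth A b \<Longrightarrow> has_bandwidth B b \<Longrightarrow> has_bandwidth (A + B) b"
  by (auto simp: has_bandwidth_def)

lemma has_bandwidth_diff:
  "A \<in> carrier_mat n n \<Longrightarrow> B \<in> carrier_mat n n \<Longrightarrow> has_bandwidth A b \<Longrightarrow> has_bandwidth B b \<Longrightarrow> has_bandwidth (A - B) b"
  by (auto simp: has_bandwidth_def)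

lemma mult_mat_vec_index_eq_0:
  assumes A: "A \<in> carrier_mat n n" and x: "x \<in> carrier_vec n" and i: "i < n"
    and b: "has_bandwidth A K" and far: "\<And>j. j < n \<Longrightarrow> x $ j \<noteq> 0 \<Longrightarrow> K < nat \<bar>int i - int j\<bar>"
  shows "(A *\<^sub>v x) $ i = 0"
proof -
  have "A $$ (i,j) * x $ j = 0" if "j < n" for j
    using far[OF that] b A i that unfolding has_bandwidth_def by (cases "x $ j = 0") auto
  thus ?thesis using A x i by (auto simp: scalar_prod_def intro!: sum.neutral)
qed

text \<open>The rank bound for an off-diagonal block of \<open>F = E\<^sup>-\<^sup>1 O\<close> with banded \<open>E\<close>, \<open>O\<close>.
  Positive definiteness of \<open>E\<close> halves the rank that the bandwidths alone would give.\<close>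

lemma banded_quotient_vanishes_off_block:
  fixes E F O' :: "real mat"
  assumes E: "E \<in> carrier_mat n n" and F: "F \<in> carrier_mat n n" and O: "O' \<in> carrier_mat n n" and EF: "E * F = O'"
    and pd: "\<And>x. x \<in> carrier_vec n \<Longrightarrow> x \<bullet> (E *\<^sub>v x) = 0 \<Longrightarrow> x = 0\<^sub>v n"
    and b: "has_bandwidth E K" "has_bandwidth O' K" and S: "S \<subseteq> {..<n}"
    and v: "v \<in> carrier_vec n" "\<And>j. j \<in> S \<Longrightarrow> v $ j = 0"
    and Fv: "\<And>i j. i \<in> S \<Longrightarrow> j < n \<Longrightarrow> j \<notin> S \<Longrightarrow> nat \<bar>int i - int j\<bar> \<le> K \<Longrightarrow> (F *\<^sub>v v) $ i = 0"
    and i: "i \<in> S"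
  shows "(F *\<^sub>v v) $ i = 0"
proof -
  define w where "w = F *\<^sub>v v"
  define x where "x = vec n (\<lambda>i. if i \<in> S then w $ i else 0)"
  define y where "y = vec n (\<lambda>i. if i \<in> S then 0 else w $ i)"
  have w: "w \<in> carrier_vec n" using F v by (simp add: w_def)
  have x: "x \<in> carrier_vec n" and y: "y \<in> carrier_vec n" by (auto simp: x_def y_def)
  have wxy: "w = x + y" using w by (intro eq_vecI) (auto simp: x_def y_def)
  have "E *\<^sub>v w = O' *\<^sub>v v" using assoc_mult_mat_vec[OF E F v(1)] EF by (simp add: w_def)
  hence Exy: "E *\<^sub>v x + E *\<^sub>v y = O' *\<^sub>v v" unfolding wxy using mult_add_distrib_mat_vec[OF E x y] by simp
  \<comment> \<open>In a row of S farther than K from the complement, E y and O' v vanish because y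
    and v live outside S, so E x vanishes there too. In the other rows x itself vanishes, by
    \<open>Fv\<close> or by definition.\<close>
  have "x $ j * (E *\<^sub>v x) $ j = 0" if j: "j < n" for j
  proof (cases "j \<in> S \<and> (\<forall>l<n. l \<notin> S \<longrightarrow> K < nat \<bar>int j - int l\<bar>)")
    case True
    have "(O' *\<^sub>v v) $ j = 0" using True v(2) by (intro mult_mat_vec_index_eq_0[OF O v(1) j b(2)]) blast
    moreover have "(E *\<^sub>v y) $ j = 0" using True by (intro mult_mat_vec_index_eq_0[OF E y j b(1)]) (auto simp: y_def split: if_splits)
    moreover have "(E *\<^sub>v x) $ j + (E *\<^sub>v y) $ j = (O' *\<^sub>v v) $ j"
      using arg_cong[OF Exy, of "\<lambda>z. z $ j"] j E O by (simp del: index_mult_mat_vec)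
    ultimately show ?thesis by simp
  next
    case False
    hence "x $ j = 0" using Fv[of j] j by (auto simp: x_def w_def[symmetric] not_less)
    thus ?thesis by simp
  qed
  hence "x \<bullet> (E *\<^sub>v x) = 0" using E by (auto simp: scalar_prod_def[of x] simp del: index_mult_mat_vec intro!: sum.neutral)
  hence "x = 0\<^sub>v n" by (rule pd[OF x])
  moreover have "i < n" using i S by auto
  ultimately show ?thesis using i by (auto simp: x_def w_def[symmetric] dest!: arg_cong[of _ _ "\<lambda>z. z $ i"])
qed

section \<open>Singular values of submatrices and the approximation error\<close>

lemma bij_betw_pick: "bij_betw (pick X) {..<card {i. i < n \<and> i \<in> X}} {i. i < n \<and> i \<in> X}"
proof -
  let ?Y = "{i. i < n \<and> i \<in> X}"
  have red: "pick X i = pick ?Y i" if "i < card ?Y" for i by (rule pick_reduce_set[OF that])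
  have "inj_on (pick ?Y) {..<card ?Y}"
    by (intro linorder_inj_onI) (auto dest: pick_mono_le)
  hence "inj_on (pick X) {..<card ?Y}" using red inj_on_cong[of "{..<card ?Y}" "pick X" "pick ?Y"] by auto
  moreover have "pick X ` {..<card ?Y} \<subseteq> ?Y" using red pick_in_set_le[of _ ?Y] by auto
  ultimately show ?thesis
    by (intro bij_betw_imageI card_subset_eq) (auto simp: card_image)
qed

text \<open>A vector on the columns J is extended by zero to length n, which keeps its norm and
  makes it vanish on S. The constraints are the rows of F in B, restricted to J, and the rows I of P
  are among those in S.\<close>

lemma sigma_submatrix_le:
  fixes P F :: "real mat"
  assumes P: "P \<in> carrier_mat n n" and F: "F \<in> carrier_mat n n" and I: "I \<subseteq> S" and S: "S \<subseteq> {..<n}" and JS: "J \<inter> S = {}"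
    and B: "finite B" "card B \<le> r" "B \<subseteq> {..<n}" and s: "s \<ge> 0"
    and H: "\<And>v. v \<in> carrier_vec n \<Longrightarrow> (\<And>j. j \<in> S \<Longrightarrow> v $ j = 0) \<Longrightarrow> (\<And>b. b \<in> B \<Longrightarrow> (F *\<^sub>v v) $ b = 0) \<Longrightarrow>
      (\<Sum>i\<in>S. ((P *\<^sub>v v) $ i)\<^sup>2) \<le> s\<^sup>2 * (v \<bullet> v)"
  shows "sigma (r + 1) (submatrix P I J) \<le> s"
proof -
  define nr where "nr = card {i. i < n \<and> i \<in> I}"
  define nc where "nc = card {j. j < n \<and> j \<in> J}"
  define M where "M = submatrix P I J"
  have M: "M \<in> carrier_mat nr nc" using P by (auto simp: M_def dim_submatrix nr_def nc_def)
  have Mij: "M $$ (i,j) = P $$ (pick I i, pick J j)" if "i < nr" "j < nc" for i j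
    unfolding M_def using that P by (intro submatrix_index) (auto simp: nr_def nc_def)
  note bij = bij_betw_pick[of _ n]
  define idx where "idx = the_inv_into {..<nc} (pick J)"
  have idx: "idx (pick J j) = j" if "j < nc" for j
    unfolding idx_def using that bij[of J] by (intro the_inv_into_f_f) (auto simp: bij_betw_def nc_def)
  define ext where "ext u = vec n (\<lambda>j. if j \<in> J then u $ idx j else 0)" for u :: "real vec"
  have ext: "ext u \<in> carrier_vec n" for u by (simp add: ext_def)
  have sum_ext: "(\<Sum>j<n. f j (ext u $ j)) = (\<Sum>j<nc. f (pick J j) (u $ j))"
    if "\<And>j. f j 0 = 0" for f :: "nat \<Rightarrow> real \<Rightarrow> real" and u
  proof -
    have "(\<Sum>j<n. f j (ext u $ j)) = (\<Sum>j\<in>{j. j < n \<and> j \<in> J}. f j (u $ idx j))"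
      using that by (intro sum.mono_neutral_cong_right) (auto simp: ext_def)
    also have "\<dots> = (\<Sum>j<nc. f (pick J j) (u $ idx (pick J j)))"
      unfolding nc_def by (rule sum.reindex_bij_betw[OF bij, symmetric])
    finally show ?thesis by (simp add: idx)
  qed
  have mult_ext: "(G *\<^sub>v ext u) $ i = (\<Sum>j<nc. G $$ (i, pick J j) * u $ j)"
    if "G \<in> carrier_mat n n" "i < n" for G u i
    using that sum_ext[of "\<lambda>j x. G $$ (i,j) * x" u] ext[of u] by (simp add: scalar_prod_def lessThan_atLeast0)
  define g where "g b = vec nc (\<lambda>j. F $$ (b, pick J j))" for b
  show ?thesis unfolding M_def[symmetric]
  proof (rule sigma_le_if_bounded_on_constraints[OF M B(1,2) _ s, of g])
    fix u :: "real vec" assume u: "u \<in> carrier_vec nc" and gu: "\<And>b. b \<in> B \<Longrightarrow> g b \<bullet> u = 0"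
    have "(F *\<^sub>v ext u) $ b = 0" if "b \<in> B" for b
    proof -
      have "b < n" using that B(3) by auto
      hence "(F *\<^sub>v ext u) $ b = g b \<bullet> u" unfolding mult_ext[OF F \<open>b < n\<close>]
        using u by (simp add: g_def scalar_prod_def lessThan_atLeast0)
      thus ?thesis using gu that by simp
    qed
    moreover have "ext u $ j = 0" if "j \<in> S" for j
    proof -
      have "j < n" "j \<notin> J" using that JS S by auto
      thus ?thesis by (simp add: ext_def)
    qed
    ultimately have "(\<Sum>i\<in>S. ((P *\<^sub>v ext u) $ i)\<^sup>2) \<le> s\<^sup>2 * (ext u \<bullet> ext u)"
      by (intro H ext)
    also have "ext u \<bullet> ext u = u \<bullet> u"
      using sum_ext[of "\<lambda>_ x. x * x" u] u ext[of u] by (simp add: scalar_prod_def lessThan_atLeast0)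
    finally have le: "(\<Sum>i\<in>S. ((P *\<^sub>v ext u) $ i)\<^sup>2) \<le> s\<^sup>2 * (u \<bullet> u)" .
    have "(M *\<^sub>v u) \<bullet> (M *\<^sub>v u) = (\<Sum>i<nr. ((P *\<^sub>v ext u) $ pick I i)\<^sup>2)"
    proof -
      have "(M *\<^sub>v u) $ i = (P *\<^sub>v ext u) $ pick I i" if "i < nr" for i
      proof -
        have "pick I i < n" using bij[of I] that by (auto simp: bij_betw_def nr_def)
        from mult_ext[OF P this] show ?thesis using that M u Mij
          by (auto simp: scalar_prod_def lessThan_atLeast0 intro!: sum.cong)
      qed
      thus ?thesis using M by (simp add: scalar_prod_def lessThan_atLeast0 power2_eq_square del: index_mult_mat_vec)
    qed
    also have "\<dots> = (\<Sum>i\<in>{i. i < n \<and> i \<in> I}. ((P *\<^sub>v ext u) $ i)\<^sup>2)"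
      unfolding nr_def by (rule sum.reindex_bij_betw[OF bij])
    also have "\<dots> \<le> (\<Sum>i\<in>S. ((P *\<^sub>v ext u) $ i)\<^sup>2)"
      using I S finite_subset[OF S] by (intro sum_mono2) auto
    finally show "(M *\<^sub>v u) \<bullet> (M *\<^sub>v u) \<le> s\<^sup>2 * (u \<bullet> u)" using le by simp
  qed (simp add: g_def)
qed

text \<open>On S the vector g(A) x vanishes, so f(A) x may be replaced there by (f - g)(A) x, whose
  norm is at most s times that of x.\<close>

lemma sum_sqs_block_le:
  assumes U: "U \<in> carrier_mat n n" "U\<^sup>T * U = 1\<^sub>m n" and x: "x \<in> carrier_vec n" and S: "S \<subseteq> {..<n}"
    and fg: "\<And>i. i < n \<Longrightarrow> \<bar>f i - g i\<bar> \<le> s" and g0: "\<And>i. i \<in> S \<Longrightarrow> (spectral_mat U g *\<^sub>v x) $ i = 0"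
  shows "(\<Sum>i\<in>S. ((spectral_mat U f *\<^sub>v x) $ i)\<^sup>2) \<le> s\<^sup>2 * (x \<bullet> x)"
proof -
  let ?D = "spectral_mat U (\<lambda>i. f i - g i)"
  have "(?D *\<^sub>v x) $ i = (spectral_mat U f *\<^sub>v x) $ i - (spectral_mat U g *\<^sub>v x) $ i" if "i < n" for i
    unfolding spectral_mat_mult_vec_index[OF U x that] by (simp add: sum_subtractf algebra_simps)
  hence "(\<Sum>i\<in>S. ((spectral_mat U f *\<^sub>v x) $ i)\<^sup>2) = (\<Sum>i\<in>S. ((?D *\<^sub>v x) $ i)\<^sup>2)"
    using S g0 by (intro sum.cong) (auto simp: subset_iff simp del: index_mult_mat_vec)
  also have "\<dots> \<le> (\<Sum>i<n. ((?D *\<^sub>v x) $ i)\<^sup>2)" using S by (intro sum_mono2) auto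
  also have "\<dots> = (?D *\<^sub>v x) \<bullet> (?D *\<^sub>v x)"
    using carrier_matD[OF spectral_mat_carrier[OF U, of "\<lambda>i. f i - g i"]]
    by (simp add: scalar_prod_def lessThan_atLeast0 power2_eq_square del: index_mult_mat_vec)
  also have "\<dots> \<le> s\<^sup>2 * (x \<bullet> x)" by (rule spectral_mat_norm_le[OF U x fg])
  finally show ?thesis .
qed

text \<open>The quotient (1 - g) / (1 + g) lies between (1 - \<epsilon>) / (1 + \<epsilon>) and its
  reciprocal. The scaling is chosen so that these end points land symmetrically about 1/2, at
  distance \<epsilon> / (1 + \<epsilon>^2).\<close>

lemma half_one_minus_scaled_cayley_bounds:
  fixes g \<epsilon> :: real
  assumes g: "\<bar>g\<bar> \<le> \<epsilon>" and \<epsilon>: "\<epsilon> < 1"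
  shows "\<bar>1 / 2 - (1 - \<epsilon>\<^sup>2) / (2 * (1 + \<epsilon>\<^sup>2)) * ((1 - g) / (1 + g))\<bar> \<le> \<epsilon>"
proof -
  have \<epsilon>0: "0 \<le> \<epsilon>" using g by simp
  have g1: "0 < 1 + g" "1 - g > 0" using g \<epsilon> by auto
  have lo: "(1 - \<epsilon>) / (1 + \<epsilon>) \<le> (1 - g) / (1 + g)" and hi: "(1 - g) / (1 + g) \<le> (1 + \<epsilon>) / (1 - \<epsilon>)"
    using g \<epsilon> \<epsilon>0 g1 by (simp_all add: divide_simps) (simp_all add: algebra_simps)
  define \<kappa> where "\<kappa> = (1 - \<epsilon>\<^sup>2) / (2 * (1 + \<epsilon>\<^sup>2))"
  have den: "0 < 1 + \<epsilon>\<^sup>2" by (simp add: add_pos_nonneg)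
  have sq: "1 - \<epsilon>\<^sup>2 = (1 - \<epsilon>) * (1 + \<epsilon>)" by (simp add: algebra_simps power2_eq_square)
  have \<kappa>: "\<kappa> \<ge> 0" unfolding \<kappa>_def sq using \<epsilon> \<epsilon>0 den by simp
  have "\<kappa> * ((1 - \<epsilon>) / (1 + \<epsilon>)) = (1 - \<epsilon>)\<^sup>2 / (2 * (1 + \<epsilon>\<^sup>2))" "\<kappa> * ((1 + \<epsilon>) / (1 - \<epsilon>)) = (1 + \<epsilon>)\<^sup>2 / (2 * (1 + \<epsilon>\<^sup>2))"
    unfolding \<kappa>_def sq using \<epsilon> \<epsilon>0 by (simp_all add: power2_eq_square)
  moreover have "(1 - \<epsilon>)\<^sup>2 / (2 * (1 + \<epsilon>\<^sup>2)) = 1 / 2 - \<epsilon> / (1 + \<epsilon>\<^sup>2)" "(1 + \<epsilon>)\<^sup>2 / (2 * (1 + \<epsilon>\<^sup>2)) = 1 / 2 + \<epsilon> / (1 + \<epsilon>\<^sup>2)"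
    using den by (simp_all add: field_simps power2_eq_square)
  moreover have "\<epsilon> / (1 + \<epsilon>\<^sup>2) \<le> \<epsilon>" using \<epsilon>0 den by (simp add: divide_le_eq mult_left_mono algebra_simps)
  ultimately show ?thesis
    using mult_left_mono[OF lo \<kappa>] mult_left_mono[OF hi \<kappa>] unfolding \<kappa>_def[symmetric] by linarith
qed

theorem theorem3p3:
  fixes R :: real and m n b :: nat and A :: "real mat" and I J :: "nat set"
  assumes "R > 1"
    and "A \<in> carrier_mat n n"
    and "transpose_mat A = A"
    and "has_bandwidth A b"
    and "\<And>e::real. eigenvalue A e \<Longrightarrow> e \<in> {-R..-1} \<union> {1..R}"
    and "off_diag_block_index n I J"
  shows "sigma (2*m*b + 1) (submatrix (Pi_neg A) I J)
     \<le> 2 * exp (- (pi^2 * real m) / (4 * ln (4 / root 4 (1/R) + 2)))"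
proof -
  obtain U d where U: "U \<in> carrier_mat n n" "U\<^sup>T * U = 1\<^sub>m n" and Ad: "A = U * mat_diag n d * U\<^sup>T"
    using symmetric_diagonalization[OF assms(2,3)] by blast
  have A: "A = spectral_mat U d" using Ad U(1) by (simp add: spectral_mat_def)
  have d: "d i \<in> {-R..-1} \<union> {1..R}" if "i < n" for i
    using assms(5) eigenvalue_spectral_mat[OF U that, of d] A by blast
  note car = spectral_mat_carrier[OF U]
  define \<theta> :: "nat \<Rightarrow> real" where "\<theta> i = (if d i < 0 then 1 else 0)" for i
  have Pi: "Pi_neg A = spectral_mat U \<theta>" unfolding A \<theta>_def by (rule Pi_neg_spectral_mat[OF U])
  obtain k where k: "k < n" "(I \<subseteq> {0..<k} \<and> J \<subseteq> {k..<n}) \<or> (I \<subseteq> {k..<n} \<and> J \<subseteq> {0..<k})"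
    using assms(6) unfolding off_diag_block_index_def by blast
  define K where "K = 2 * m * b"
  \<comment> \<open>S is the side of the cut containing the rows of the block, and B is the strip of
    width K in S along the cut. Only rows in B lie within K of the other side, which leaves at most
    K constraints.\<close>
  obtain S B where S: "I \<subseteq> S" "S \<subseteq> {..<n}" "J \<inter> S = {}" and B: "finite B" "card B \<le> K" "B \<subseteq> {..<n}"
    and SB: "\<And>i j. i \<in> S \<Longrightarrow> j < n \<Longrightarrow> j \<notin> S \<Longrightarrow> nat \<bar>int i - int j\<bar> \<le> K \<Longrightarrow> i \<in> B"
  proof (cases "I \<subseteq> {0..<k} \<and> J \<subseteq> {k..<n}")
    case True
    show ?thesis
      by (rule that[of "{0..<k}" "{k - K..<k}"]) (use True k in auto)
  next
    case False
    hence IJ: "I \<subseteq> {k..<n}" "J \<subseteq> {0..<k}" using k by auto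
    have "card ({k..<k + K} \<inter> {..<n}) \<le> card {k..<k + K}" by (intro card_mono) auto
    thus ?thesis
      using IJ k by (intro that[of "{k..<n}" "{k..<k + K} \<inter> {..<n}"]) auto
  qed
  define L' where "L' = 4 * ln (4 / root 4 (1/R) + 2)"
  \<comment> \<open>Here L' = 4 ln(4 r + 2) with r the fourth root of R, and 4 ln(4 r) is already ln
    R + 2 ln 16.\<close>
  have L': "L' \<ge> ln R + 2 * ln 16"
  proof -
    define r where "r = root 4 R"
    have r: "r > 0" "r ^ 4 = R" using assms(1) by (auto simp: r_def)
    have "ln (4 * r) \<le> ln (4 * r + 2)" using r by (subst ln_le_cancel_iff) auto
    hence "4 * ln (4 * r + 2) \<ge> 4 * (ln 4 + ln r)" using r by (simp add: ln_mult)
    moreover have "ln R = 4 * ln r" using r ln_realpow[of r 4] by simp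
    moreover have "2 * ln (16::real) = 4 * ln 4" using ln_realpow[of "4::real" 2] by simp
    moreover have "L' = 4 * ln (4 * r + 2)" by (simp add: L'_def r_def real_root_divide)
    ultimately show ?thesis by simp
  qed
  have "0 \<le> ln R" using assms(1) by simp
  moreover have "0 < ln (16::real)" by simp
  ultimately have L'0: "L' > 0" using L' by linarith
  define \<epsilon> where "\<epsilon> = 2 * exp (- (pi^2 * real m / L'))"
  have \<epsilon>0: "\<epsilon> > 0" by (simp add: \<epsilon>_def)
  have "sigma (K + 1) (submatrix (spectral_mat U \<theta>) I J) \<le> \<epsilon>"
  proof (cases "\<epsilon> < 1 / 2")
    case False
    \<comment> \<open>Off the diagonal the projector coincides with \<open>\<Pi> - I/2\<close>, which has norm \<open>1/2\<close>.\<close>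
    show ?thesis
    proof (rule sigma_submatrix_le[OF car car S, of "{}"])
      fix v :: "real vec" assume v: "v \<in> carrier_vec n" and vS: "\<And>j. j \<in> S \<Longrightarrow> v $ j = 0"
      have "(spectral_mat U (\<lambda>_. 1 / 2) *\<^sub>v v) $ i = 0" if "i \<in> S" for i
      proof -
        have i: "i < n" using that S by auto
        have "(spectral_mat U (\<lambda>_. 1 / 2) *\<^sub>v v) $ i = 1 / 2 * (spectral_mat U (\<lambda>_. 1) *\<^sub>v v) $ i"
          unfolding spectral_mat_mult_vec_index[OF U v i] by (simp add: sum_distrib_left)
        thus ?thesis using v vS[OF that] by (simp add: spectral_mat_one[OF U])
      qed
      thus "(\<Sum>i\<in>S. ((spectral_mat U \<theta> *\<^sub>v v) $ i)\<^sup>2) \<le> \<epsilon>\<^sup>2 * (v \<bullet> v)"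
        using False by (intro sum_sqs_block_le[OF U v S(2), where g = "\<lambda>_. 1 / 2"]) (auto simp: \<theta>_def)
    qed (use \<epsilon>0 in auto)
  next
    case True
    have m: "m > 0" using True by (cases "m = 0") (auto simp: \<epsilon>_def)
    \<comment> \<open>With 2m nodes the exponent of the interval estimate is the one in \<epsilon>,
      and its smallness condition is exactly \<epsilon> < 1/2.\<close>
    have e: "pi\<^sup>2 * real (2 * m) / (2 * L') = pi^2 * real m / L'" by simp
    have "\<exists>p. (\<forall>j<2 * m. p j > 0) \<and>
      (\<forall>x\<in>{1..R}. (\<Prod>j<2 * m. \<bar>x - p j\<bar> / (x + p j)) \<le> 2 * exp (- (pi\<^sup>2 * real (2 * m) / (2 * L'))))"
      by (rule exists_small_quotient_on_interval[OF _ _ L']) (use assms(1) m True in \<open>auto simp: e \<epsilon>_def\<close>)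
    then obtain p where p: "\<And>j. j < 2 * m \<Longrightarrow> p j > 0"
      and p_le: "\<And>x. x \<in> {1..R} \<Longrightarrow> (\<Prod>j<2 * m. \<bar>x - p j\<bar> / (x + p j)) \<le> \<epsilon>"
      unfolding e \<epsilon>_def by blast
    define q where "q x = (\<Prod>j<2 * m. x + p j)" for x
    have q_pos: "q x > 0" if "x \<ge> 1" for x
      unfolding q_def using p that by (intro prod_pos) (auto intro: add_pos_pos)
    have q_le: "\<bar>q (- x)\<bar> \<le> \<epsilon> * q x" if x: "x \<in> {1..R}" for x
    proof -
      have "\<bar>q (- x)\<bar> / q x = (\<Prod>j<2 * m. \<bar>x - p j\<bar> / (x + p j))"
        unfolding q_def by (simp add: abs_prod prod_dividef abs_minus_commute)
      hence "\<bar>q (- x)\<bar> / q x \<le> \<epsilon>" using p_le[OF x] by (simp only:)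
      thus ?thesis using q_pos[of x] x by (simp add: pos_divide_le_eq)
    qed
    define \<rho> where "\<rho> x = (q x - q (- x)) / (q x + q (- x))" for x
    have q_sum: "q x + q (- x) > 0" if x: "x \<in> {1..R}" for x
    proof -
      have "\<epsilon> * q x < 1 * q x" using q_pos[of x] x True by (intro mult_strict_right_mono) auto
      thus ?thesis using q_le[OF x] by linarith
    qed
    \<comment> \<open>The sum is even in its argument, so positivity on [1, R] also covers negative
      eigenvalues. It makes \<open>?E\<close> positive definite and keeps the denominators of \<rho>
      nonzero on the spectrum.\<close>
    have q_sum': "q (d i) + q (- d i) > 0" if "i < n" for i
      using d[OF that] q_sum[of "d i"] q_sum[of "- d i"] by (auto simp: add.commute)
    define \<kappa> where "\<kappa> = (1 - \<epsilon>\<^sup>2) / (2 * (1 + \<epsilon>\<^sup>2))"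
    have approx: "\<bar>1 / 2 - \<kappa> * \<rho> x\<bar> \<le> \<epsilon>" if x: "x \<in> {1..R}" for x
    proof -
      define g where "g = q (- x) / q x"
      have "\<bar>g\<bar> \<le> \<epsilon>" using q_le[OF x] q_pos[of x] x by (simp add: g_def divide_le_eq)
      moreover have "\<rho> x = (1 - g) / (1 + g)"
      proof -
        have "1 - g = (q x - q (- x)) / q x" "1 + g = (q x + q (- x)) / q x"
          using q_pos[of x] x by (auto simp: g_def field_simps)
        thus ?thesis using q_pos[of x] x by (simp add: \<rho>_def)
      qed
      ultimately show ?thesis unfolding \<kappa>_def using half_one_minus_scaled_cayley_bounds[of g \<epsilon>] True by simp
    qed
    have \<rho>_minus: "\<rho> (- x) = - \<rho> x" for x
      by (simp add: \<rho>_def add.commute minus_divide_left)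
    let ?E = "spectral_mat U (\<lambda>i. q (d i) + q (- d i))"
    let ?O = "spectral_mat U (\<lambda>i. q (d i) - q (- d i))"
    let ?F = "spectral_mat U (\<lambda>i. \<rho> (d i))"
    have EF: "?E * ?F = ?O" unfolding spectral_mat_mult[OF U]
    proof (rule spectral_mat_cong[OF U])
      fix i assume "i < n"
      from q_sum'[OF this] show "(q (d i) + q (- d i)) * \<rho> (d i) = q (d i) - q (- d i)" by (simp add: \<rho>_def)
    qed
    have bw: "has_bandwidth (spectral_mat U (\<lambda>i. q (d i))) K" "has_bandwidth (spectral_mat U (\<lambda>i. q (- d i))) K"
      using has_bandwidth_spectral_mat_prod[OF U assms(4)[unfolded A], where k = "2 * m" and c = 1 and p = p]
        has_bandwidth_spectral_mat_prod[OF U assms(4)[unfolded A], where k = "2 * m" and c = "- 1" and p = p]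
      by (simp_all add: q_def K_def)
    have bwE: "has_bandwidth ?E K" "has_bandwidth ?O K"
      using has_bandwidth_add[OF car car bw] has_bandwidth_diff[OF car car bw]
      by (simp_all add: spectral_mat_add[OF U] spectral_mat_diff[OF U])
    show ?thesis
    proof (rule sigma_submatrix_le[OF car car[of "\<lambda>i. \<rho> (d i)"] S B])
      fix v :: "real vec" assume v: "v \<in> carrier_vec n" and vS: "\<And>j. j \<in> S \<Longrightarrow> v $ j = 0"
        and vB: "\<And>b. b \<in> B \<Longrightarrow> (?F *\<^sub>v v) $ b = 0"
      have F0: "(?F *\<^sub>v v) $ i = 0" if "i \<in> S" for i
      proof (rule banded_quotient_vanishes_off_block[OF car car car EF _ bwE S(2) v _ _ that])
        fix x :: "real vec" assume "x \<in> carrier_vec n" "x \<bullet> (?E *\<^sub>v x) = 0"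
        thus "x = 0\<^sub>v n" using spectral_mat_pos_def[OF U, of x "\<lambda>i. q (d i) + q (- d i)"] q_sum' by metis
      next
        fix i j assume "i \<in> S" "j < n" "j \<notin> S" "nat \<bar>int i - int j\<bar> \<le> K"
        thus "(?F *\<^sub>v v) $ i = 0" by (intro vB SB)
      qed (rule vS)
      \<comment> \<open>Both v and \<open>?F *\<^sub>v v\<close> vanish on S, hence so does the
        image of v under the approximant I/2 - \<kappa> F.\<close>
      have "(spectral_mat U (\<lambda>i. 1 / 2 - \<kappa> * \<rho> (d i)) *\<^sub>v v) $ i = 0" if "i \<in> S" for i
      proof -
        have i: "i < n" using that S by auto
        have "(spectral_mat U (\<lambda>i. 1 / 2 - \<kappa> * \<rho> (d i)) *\<^sub>v v) $ i
          = 1 / 2 * (spectral_mat U (\<lambda>_. 1) *\<^sub>v v) $ i - \<kappa> * (?F *\<^sub>v v) $ i"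
          unfolding spectral_mat_mult_vec_index[OF U v i]
          by (simp add: sum_distrib_left sum_subtractf algebra_simps)
        thus ?thesis using v vS[OF that] F0[OF that] by (simp add: spectral_mat_one[OF U])
      qed
      \<comment> \<open>For a negative eigenvalue, 1 - (1/2 - \<kappa> \<rho>(d i)) = 1/2 - \<kappa>
        \<rho>(-d i) because \<rho> is odd, so the estimate on [1, R] serves both signs.\<close>
      moreover have "\<bar>\<theta> i - (1 / 2 - \<kappa> * \<rho> (d i))\<bar> \<le> \<epsilon>" if "i < n" for i
      proof (cases "d i < 0")
        case True
        hence "- d i \<in> {1..R}" using d[OF that] by auto
        from approx[OF this] True show ?thesis by (simp add: \<theta>_def \<rho>_minus)
      next
        case False
        hence "d i \<in> {1..R}" using d[OF that] by auto
        from approx[OF this] False show ?thesis by (simp add: \<theta>_def)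
      qed
      ultimately show "(\<Sum>i\<in>S. ((spectral_mat U \<theta> *\<^sub>v v) $ i)\<^sup>2) \<le> \<epsilon>\<^sup>2 * (v \<bullet> v)"
        by (intro sum_sqs_block_le[OF U v S(2), where g = "\<lambda>i. 1 / 2 - \<kappa> * \<rho> (d i)"])
    qed (use \<epsilon>0 in auto)
  qed
  thus ?thesis unfolding Pi K_def \<epsilon>_def L'_def by simp
qed

end
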